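(* Let $\mathcal{L}$ be a finite-dimensional, not necessarily unital, associative algebra over a field. For arbitrary $r[h]\in h(\mathcal{L}\otimes\mathcal{L})[[h]]$, the directed double product integral $\stackrel{\rightarrow\leftarrow}{\prod}(1+dr[h])$ is invertible in $(\mathcal{T}(\mathcal{L})\otimes\mathcal{T}(\mathcal{L}))[[h]]$ with inverse $\stackrel{\leftarrow\rightarrow}{\prod}(1+dr'[h])$, where $r'[h]$ is the quasiinverse of $r[h]$ in $h(\mathcal{L}\otimes\mathcal{L})[[h]]$, that is, the unique element satisfying $$r[h]+r'[h]+r[h]r'[h]=r'[h]+r[h]+r'[h]r[h]=0.$$
   Context: Itô Hopf algebra. $\mathcal{T}(\mathcal{L})=\bigoplus_{n=0}^\infty\bigotimes^n\mathcal{L}$ (with $\bigotimes^0\mathcal{L}$ the ground field) is the space of all tensors over $\mathcal{L}$; elements of $\bigotimes^n\mathcal{L}$ are said to have rank $n$. It is equipped with the Itô (noncommutative extension of the shuffle) product, the unital associative product given by $$(\alpha\beta)_n=\sum_{A\cup B=\{1,\ldots,n\}}\alpha_{|A|}^{A}\,\beta_{|B|}^{B},$$ the sum being over ordered pairs $(A,B)$ of subsets, not necessarily disjoint, with union $\{1,\ldots,n\}$; here $\alpha_{|A|}^A$ means that the rank-$|A|$ component of $\alpha$ is placed, in order, in the copies of $\mathcal{L}$ labelled by $A$, similarly for $\beta$, and in places belonging to $A\cap B$ one multiplies in $\mathcal{L}$ (the factor from $\alpha$ on the left). The unit is $1_{\mathcal{T}(\mathcal{L})}=(1,0,0,\ldots)$.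 Formal power series. For a vector space $V$, $V[[h]]$ is the space of formal power series in $h$ with coefficients in $V$, and $hV[[h]]$ those with vanishing constant term. If $V$ is an algebra, $V[[h]]$ has the convolution (Cauchy) product. Tensor products of algebras have componentwise multiplication. Place notation. Superscripts indicate the tensor places occupied, a unit being inserted in the other places (for $\mathcal{L}$ itself one uses the unit of the algebra $\mathcal{L}'$ obtained by adjoining a unit to $\mathcal{L}$). Product integrals. For an associative algebra $\mathcal{A}$ and $l[h]\in h(\mathcal{A}\otimes\mathcal{L})[[h]]$, define the decapitated product integrals in $(\mathcal{A}\otimes\mathcal{T}(\mathcal{L}))[[h]]$ $${}_{\mathcal{A}}\widehat{\stackrel{\rightarrow}{\prod}}(1+dl[h])=\sum_{n=1}^\infty l^{1,2}[h]l^{1,3}[h]\cdots l^{1,n+1}[h],\qquad {}_{\mathcal{A}}\widehat{\stackrel{\leftarrow}{\prod}}(1+dl[h])=\sum_{n=1}^\infty l^{1,n+1}[h]l^{1,n}[h]\cdots l^{1,2}[h],$$ where the $n$-th summand lies in $(\mathcal{A}\otimes\bigotimes^n\mathcal{L})[[h]]$ (place 1 is $\mathcal{A}$, where multiplication takes place, and places $2,\ldots,n+1$ are the copies of $\mathcal{L}$). Analogously, for $m[h]\in h(\mathcal{L}\otimes\mathcal{A})[[h]]$, define in $(\mathcal{T}(\mathcal{L})\otimes\mathcal{A})[[h]]$ $$\widehat{\stackrel{\rightarrow}{\prod}}_{\mathcal{A}}(1+dm[h])=\sum_{n=1}^\infty m^{1,n+1}[h]m^{2,n+1}[h]\cdots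 m^{n,n+1}[h],\qquad \widehat{\stackrel{\leftarrow}{\prod}}_{\mathcal{A}}(1+dm[h])=\sum_{n=1}^\infty m^{n,n+1}[h]m^{n-1,n+1}[h]\cdots m^{1,n+1}[h].$$ When $\mathcal{A}$ is unital, the (non-decapitated) product integrals, written without hats, are obtained by adding the unit element $1_{\mathcal{A}}\otimes 1_{\mathcal{T}(\mathcal{L})}$ (respectively $1_{\mathcal{T}(\mathcal{L})}\otimes1_{\mathcal{A}}$). Directed double product integrals. For $r[h]\in h(\mathcal{L}\otimes\mathcal{L})[[h]]$, $$\stackrel{\rightarrow\leftarrow}{\prod}(1+dr[h])={}_{\mathcal{T}(\mathcal{L})}\stackrel{\rightarrow}{\prod}\Bigl(1+d\bigl(\widehat{\stackrel{\leftarrow}{\prod}}_{\mathcal{L}}(1+dr[h])\bigr)\Bigr)=\stackrel{\leftarrow}{\prod}_{\mathcal{T}(\mathcal{L})}\Bigl(1+d\bigl({}_{\mathcal{L}}\widehat{\stackrel{\rightarrow}{\prod}}(1+dr[h])\bigr)\Bigr),$$ $$\stackrel{\leftarrow\rightarrow}{\prod}(1+dr[h])={}_{\mathcal{T}(\mathcal{L})}\stackrel{\leftarrow}{\prod}\Bigl(1+d\bigl(\widehat{\stackrel{\rightarrow}{\prod}}_{\mathcal{L}}(1+dr[h])\bigr)\Bigr)=\stackrel{\rightarrow}{\prod}_{\mathcal{T}(\mathcal{L})}\Bigl(1+d\bigl({}_{\mathcal{L}}\widehat{\stackrel{\leftarrow}{\prod}}(1+dr[h])\bigr)\Bigr),$$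 elements of $(\mathcal{T}(\mathcal{L})\otimes\mathcal{T}(\mathcal{L}))[[h]]$; in each case the two iterated expressions are known to be equal. *)

theory Defs
  imports
    "HOL-Library.Poly_Mapping"
    "HOL-Computational_Algebra.Formal_Power_Series"
begin

section \<open>Formal linear combinations\<close>

text \<open>
  Every vector space below is presented as a quotient \<open>F(X) / R\<close>, where \<open>F(X)\<close> is the space
  \<^typ>\<open>'x \<Rightarrow>\<^sub>0 'k\<close> of formal linear combinations of generators and \<open>R\<close> is a subspace of relations.
  Elements are handled through representatives in \<open>F(X)\<close>, and two representatives denote the same
  element iff their difference lies in \<open>R\<close>.  Operations are given on generators and extended
  (bi)linearly; the lemmas named \<open>*_descends\<close> and \<open>*_well_defined\<close> show that they descend to the
  quotients.
\<close>

definition fscale :: "'k::field \<Rightarrow> ('x \<Rightarrow>\<^sub>0 'k) \<Rightarrow> ('x \<Rightarrow>\<^sub>0 'k)" where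
  "fscale c p = Poly_Mapping.map ((*) c) p"

abbreviation gen :: "'x \<Rightarrow> ('x \<Rightarrow>\<^sub>0 'k::field)" where
  "gen x \<equiv> Poly_Mapping.single x 1"

lemma lookup_fscale [simp]: "Poly_Mapping.lookup (fscale c p) x = c * Poly_Mapping.lookup p x"
  by (simp add: fscale_def Poly_Mapping.map.rep_eq when_def)

lemma vector_space_fscale: "vector_space (fscale :: 'k::field \<Rightarrow> ('x \<Rightarrow>\<^sub>0 'k) \<Rightarrow> _)"
  by unfold_locales (auto intro!: poly_mapping_eqI simp: lookup_add algebra_simps)

interpretation free: vector_space "fscale :: 'k::field \<Rightarrow> ('x \<Rightarrow>\<^sub>0 'k) \<Rightarrow> ('x \<Rightarrow>\<^sub>0 'k)"
  by (rule vector_space_fscale)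

definition lin_ext :: "('x \<Rightarrow> ('y \<Rightarrow>\<^sub>0 'k::field)) \<Rightarrow> ('x \<Rightarrow>\<^sub>0 'k) \<Rightarrow> ('y \<Rightarrow>\<^sub>0 'k)" where
  "lin_ext f p = (\<Sum>x\<in>Poly_Mapping.keys p. fscale (Poly_Mapping.lookup p x) (f x))"

definition bilin_ext ::
    "('x \<Rightarrow> 'y \<Rightarrow> ('z \<Rightarrow>\<^sub>0 'k::field)) \<Rightarrow> ('x \<Rightarrow>\<^sub>0 'k) \<Rightarrow> ('y \<Rightarrow>\<^sub>0 'k) \<Rightarrow> ('z \<Rightarrow>\<^sub>0 'k)" where
  "bilin_ext f p q = lin_ext (\<lambda>x. lin_ext (f x) q) p"

text \<open>The canonical bilinear map \<open>F(X) \<times> F(Y) \<rightarrow> F(X \<times> Y)\<close>.\<close>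

definition tensor :: "('x \<Rightarrow>\<^sub>0 'k::field) \<Rightarrow> ('y \<Rightarrow>\<^sub>0 'k) \<Rightarrow> ('x \<times> 'y \<Rightarrow>\<^sub>0 'k)" where
  "tensor = bilin_ext (\<lambda>x y. gen (x, y))"


section \<open>Relations\<close>

text \<open>\<open>F(L) / lin_rel\<close> is \<open>L\<close> itself.\<close>

definition lin_rel :: "('k::field \<Rightarrow> 'a::ring \<Rightarrow> 'a) \<Rightarrow> ('a \<Rightarrow>\<^sub>0 'k) set" where
  "lin_rel scale = free.span
     ({gen (x + y) - gen x - gen y | x y. True} \<union> {gen (scale c x) - fscale c (gen x) | c x. True})"

text \<open>
  \<open>F(L list) / multilin_rel\<close> is the tensor space \<open>T(L)\<close>: the word \<open>[x\<^sub>1, \<dots>, x\<^sub>n]\<close> denotes the pure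
  tensor \<open>x\<^sub>1 \<otimes> \<dots> \<otimes> x\<^sub>n\<close> of rank \<open>n\<close>, and words are subject to linearity in each letter.
\<close>

definition multilin_rel :: "('k::field \<Rightarrow> 'a::ring \<Rightarrow> 'a) \<Rightarrow> ('a list \<Rightarrow>\<^sub>0 'k) set" where
  "multilin_rel scale = free.span
     {lin_ext (\<lambda>z. gen (u @ z # v)) p | u v p. p \<in> lin_rel scale}"

text \<open>\<open>F(X \<times> Y) / tensor_rel R S\<close> is \<open>F(X) / R \<otimes> F(Y) / S\<close>.\<close>

definition tensor_rel ::
    "('x \<Rightarrow>\<^sub>0 'k::field) set \<Rightarrow> ('y \<Rightarrow>\<^sub>0 'k) set \<Rightarrow> ('x \<times> 'y \<Rightarrow>\<^sub>0 'k) set" where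
  "tensor_rel R S = free.span
     ({tensor p (gen y) | p y. p \<in> R} \<union> {tensor (gen x) q | x q. q \<in> S})"

abbreviation LL_rel :: "('k::field \<Rightarrow> 'a::ring \<Rightarrow> 'a) \<Rightarrow> ('a \<times> 'a \<Rightarrow>\<^sub>0 'k) set" where
  "LL_rel scale \<equiv> tensor_rel (lin_rel scale) (lin_rel scale)"

abbreviation TT_rel :: "('k::field \<Rightarrow> 'a::ring \<Rightarrow> 'a) \<Rightarrow> ('a list \<times> 'a list \<Rightarrow>\<^sub>0 'k) set" where
  "TT_rel scale \<equiv> tensor_rel (multilin_rel scale) (multilin_rel scale)"


section \<open>Multiplications on generators\<close>

definition L_mul :: "'a::ring \<Rightarrow> 'a \<Rightarrow> ('a \<Rightarrow>\<^sub>0 'k::field)" where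
  "L_mul x y = gen (x * y)"

text \<open>
  The summand of the Ito product of the words \<open>u\<close> and \<open>v\<close> in which the letters of \<open>u\<close> are put, in
  order, in the places \<open>A\<close> and those of \<open>v\<close> in the places \<open>B\<close>, where \<open>A \<union> B = {0, \<dots>, n - 1}\<close>.
\<close>

definition place_letter :: "nat set \<Rightarrow> 'a list \<Rightarrow> nat \<Rightarrow> 'a" where
  "place_letter A u i = u ! card {j \<in> A. j < i}"

definition ito_word :: "nat set \<Rightarrow> nat set \<Rightarrow> nat \<Rightarrow> 'a::ring list \<Rightarrow> 'a list \<Rightarrow> 'a list" where
  "ito_word A B n u v = map (\<lambda>i.
       if i \<in> A \<and> i \<in> B then place_letter A u i * place_letter B v i
       else if i \<in> A then place_letter A u i
       else place_letter B v i) [0..<n]"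

text \<open>
  A pair \<open>(A, B)\<close> contributes to the product of words of lengths \<open>|A|\<close> and \<open>|B|\<close> only, so the rank
  \<open>n\<close> is at most \<open>length u + length v\<close>.
\<close>

definition ito_mul :: "'a::ring list \<Rightarrow> 'a list \<Rightarrow> ('a list \<Rightarrow>\<^sub>0 'k::field)" where
  "ito_mul u v = (\<Sum>n\<le>length u + length v.
     \<Sum>(A, B) | A \<union> B = {..<n} \<and> card A = length u \<and> card B = length v. gen (ito_word A B n u v))"

text \<open>The tensor product of two bilinear maps; for two multiplications this is the componentwise one.\<close>

definition tensor_mul ::
    "('x \<Rightarrow> 'x' \<Rightarrow> ('x'' \<Rightarrow>\<^sub>0 'k::field)) \<Rightarrow> ('y \<Rightarrow> 'y' \<Rightarrow> ('y'' \<Rightarrow>\<^sub>0 'k)) \<Rightarrow>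
     'x \<times> 'y \<Rightarrow> 'x' \<times> 'y' \<Rightarrow> ('x'' \<times> 'y'' \<Rightarrow>\<^sub>0 'k)" where
  "tensor_mul f g = (\<lambda>(x, y) (x', y'). tensor (f x x') (g y y'))"

definition snoc :: "'a list \<Rightarrow> 'a \<Rightarrow> ('a list \<Rightarrow>\<^sub>0 'k::field)" where
  "snoc w x = gen (w @ [x])"


section \<open>Formal power series\<close>

text \<open>The Cauchy product induced by a bilinear map on coefficients.\<close>

definition fps_bilin ::
    "('x \<Rightarrow> 'y \<Rightarrow> ('z \<Rightarrow>\<^sub>0 'k::field)) \<Rightarrow> ('x \<Rightarrow>\<^sub>0 'k) fps \<Rightarrow> ('y \<Rightarrow>\<^sub>0 'k) fps \<Rightarrow> ('z \<Rightarrow>\<^sub>0 'k) fps" where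
  "fps_bilin f p q = Abs_fps (\<lambda>N. \<Sum>i\<le>N. bilin_ext f (fps_nth p i) (fps_nth q (N - i)))"

definition fps_lin ::
    "('x \<Rightarrow> ('y \<Rightarrow>\<^sub>0 'k::field)) \<Rightarrow> ('x \<Rightarrow>\<^sub>0 'k) fps \<Rightarrow> ('y \<Rightarrow>\<^sub>0 'k) fps" where
  "fps_lin f p = Abs_fps (\<lambda>N. lin_ext f (fps_nth p N))"

text \<open>Equality in \<open>(F(X) / R)[[h]]\<close>.\<close>

definition fps_equiv ::
    "('x \<Rightarrow>\<^sub>0 'k::field) set \<Rightarrow> ('x \<Rightarrow>\<^sub>0 'k) fps \<Rightarrow> ('x \<Rightarrow>\<^sub>0 'k) fps \<Rightarrow> bool" where
  "fps_equiv R p q \<longleftrightarrow> (\<forall>N. fps_nth p N - fps_nth q N \<in> R)"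

abbreviation LL_equiv ::
    "('k::field \<Rightarrow> 'a::ring \<Rightarrow> 'a) \<Rightarrow> ('a \<times> 'a \<Rightarrow>\<^sub>0 'k) fps \<Rightarrow> ('a \<times> 'a \<Rightarrow>\<^sub>0 'k) fps \<Rightarrow> bool" where
  "LL_equiv scale \<equiv> fps_equiv (LL_rel scale)"

abbreviation TT_equiv ::
    "('k::field \<Rightarrow> 'a::ring \<Rightarrow> 'a) \<Rightarrow>
     ('a list \<times> 'a list \<Rightarrow>\<^sub>0 'k) fps \<Rightarrow> ('a list \<times> 'a list \<Rightarrow>\<^sub>0 'k) fps \<Rightarrow> bool" where
  "TT_equiv scale \<equiv> fps_equiv (TT_rel scale)"

definition LL_times ::
    "('a::ring \<times> 'a \<Rightarrow>\<^sub>0 'k::field) fps \<Rightarrow> ('a \<times> 'a \<Rightarrow>\<^sub>0 'k) fps \<Rightarrow> ('a \<times> 'a \<Rightarrow>\<^sub>0 'k) fps" where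
  "LL_times = fps_bilin (tensor_mul L_mul L_mul)"

definition TT_times ::
    "('a::ring list \<times> 'a list \<Rightarrow>\<^sub>0 'k::field) fps \<Rightarrow> ('a list \<times> 'a list \<Rightarrow>\<^sub>0 'k) fps \<Rightarrow>
     ('a list \<times> 'a list \<Rightarrow>\<^sub>0 'k) fps" where
  "TT_times = fps_bilin (tensor_mul ito_mul ito_mul)"

definition TT_one :: "('a list \<times> 'a list \<Rightarrow>\<^sub>0 'k::field) fps" where
  "TT_one = fps_const (gen ([], []))"


section \<open>Product integrals\<close>

text \<open>
  Below \<open>f\<close> is the multiplication of the system algebra \<open>A\<close> on its generators.  In the \<open>n\<close>-fold
  product \<open>l\<^bsup>1,2\<^esup> l\<^bsup>1,3\<^esup> \<cdots> l\<^bsup>1,n+1\<^esup>\<close> the only place occupied by more than one factor is that of \<open>A\<close>, so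
  multiplying by the factor \<open>l\<^bsup>1,n+1\<^esup>\<close> multiplies in \<open>A\<close> (on the right or on the left according to
  the direction) and appends a letter to the word.  The term with index \<open>n\<close> has \<open>n + 1\<close> factors.
\<close>

primrec left_fwd_term ::
    "('x \<Rightarrow> 'x \<Rightarrow> ('x \<Rightarrow>\<^sub>0 'k::field)) \<Rightarrow> ('x \<times> 'a \<Rightarrow>\<^sub>0 'k) fps \<Rightarrow> nat \<Rightarrow> ('x \<times> 'a list \<Rightarrow>\<^sub>0 'k) fps" where
  "left_fwd_term f l 0 = fps_lin (\<lambda>(a, x). gen (a, [x])) l"
| "left_fwd_term f l (Suc n) =
     fps_bilin (tensor_mul f snoc) (left_fwd_term f l n) l"

primrec left_bwd_term ::
    "('x \<Rightarrow> 'x \<Rightarrow> ('x \<Rightarrow>\<^sub>0 'k::field)) \<Rightarrow> ('x \<times> 'a \<Rightarrow>\<^sub>0 'k) fps \<Rightarrow> nat \<Rightarrow> ('x \<times> 'a list \<Rightarrow>\<^sub>0 'k) fps" where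
  "left_bwd_term f l 0 = fps_lin (\<lambda>(a, x). gen (a, [x])) l"
| "left_bwd_term f l (Suc n) =
     fps_bilin (tensor_mul f (\<lambda>x w. snoc w x)) l (left_bwd_term f l n)"

primrec right_fwd_term ::
    "('x \<Rightarrow> 'x \<Rightarrow> ('x \<Rightarrow>\<^sub>0 'k::field)) \<Rightarrow> ('a \<times> 'x \<Rightarrow>\<^sub>0 'k) fps \<Rightarrow> nat \<Rightarrow> ('a list \<times> 'x \<Rightarrow>\<^sub>0 'k) fps" where
  "right_fwd_term f m 0 = fps_lin (\<lambda>(x, a). gen ([x], a)) m"
| "right_fwd_term f m (Suc n) =
     fps_bilin (tensor_mul snoc f) (right_fwd_term f m n) m"

primrec right_bwd_term ::
    "('x \<Rightarrow> 'x \<Rightarrow> ('x \<Rightarrow>\<^sub>0 'k::field)) \<Rightarrow> ('a \<times> 'x \<Rightarrow>\<^sub>0 'k) fps \<Rightarrow> nat \<Rightarrow> ('a list \<times> 'x \<Rightarrow>\<^sub>0 'k) fps" where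
  "right_bwd_term f m 0 = fps_lin (\<lambda>(x, a). gen ([x], a)) m"
| "right_bwd_term f m (Suc n) =
     fps_bilin (tensor_mul (\<lambda>x w. snoc w x) f) m (right_bwd_term f m n)"

text \<open>
  If the constant term of the integrand is zero, then the coefficients below \<open>h\<^sup>n\<close> of a product of
  \<open>n\<close> factors vanish, so the coefficient of \<open>h\<^sup>N\<close> in the infinite sum over the number of factors
  is the finite sum over the products of at most \<open>N\<close> factors.
\<close>

definition hsum :: "(nat \<Rightarrow> ('x \<Rightarrow>\<^sub>0 'k::field) fps) \<Rightarrow> ('x \<Rightarrow>\<^sub>0 'k) fps" where
  "hsum t = Abs_fps (\<lambda>N. \<Sum>n<N. fps_nth (t n) N)"

definition left_fwd_hat where "left_fwd_hat f l = hsum (left_fwd_term f l)"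
definition left_bwd_hat where "left_bwd_hat f l = hsum (left_bwd_term f l)"
definition right_fwd_hat where "right_fwd_hat f m = hsum (right_fwd_term f m)"
definition right_bwd_hat where "right_bwd_hat f m = hsum (right_bwd_term f m)"

text \<open>
  The arrows refer to the first and second tensor factor: \<open>double_fwd_bwd\<close> is the product integral
  with arrows right, left.  Iterating in the other order (first over the second tensor factor) gives
  the same series.
\<close>

definition double_fwd_bwd ::
    "('a::ring \<times> 'a \<Rightarrow>\<^sub>0 'k::field) fps \<Rightarrow> ('a list \<times> 'a list \<Rightarrow>\<^sub>0 'k) fps" where
  "double_fwd_bwd r = TT_one + left_fwd_hat ito_mul (right_bwd_hat L_mul r)"

definition double_bwd_fwd ::
    "('a::ring \<times> 'a \<Rightarrow>\<^sub>0 'k::field) fps \<Rightarrow> ('a list \<times> 'a list \<Rightarrow>\<^sub>0 'k) fps" where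
  "double_bwd_fwd r = TT_one + left_bwd_hat ito_mul (right_fwd_hat L_mul r)"


section \<open>Algebras, inverses and quasiinverses\<close>

locale fin_dim_algebra = finite_dimensional_vector_space scale Basis
  for scale :: "'k::field \<Rightarrow> 'a::ring \<Rightarrow> 'a" and Basis :: "'a set" +
  assumes scale_mult_left: "scale c (x * y) = scale c x * y"
    and scale_mult_right: "scale c (x * y) = x * scale c y"

text \<open>
  An element of \<open>h(L \<otimes> L)[[h]]\<close> is represented by a series whose constant term is literally zero;
  every such element has a representative of this form.
\<close>

definition is_quasiinverse ::
    "('k::field \<Rightarrow> 'a::ring \<Rightarrow> 'a) \<Rightarrow> ('a \<times> 'a \<Rightarrow>\<^sub>0 'k) fps \<Rightarrow> ('a \<times> 'a \<Rightarrow>\<^sub>0 'k) fps \<Rightarrow> bool" where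
  "is_quasiinverse scale r r' \<longleftrightarrow> fps_nth r' 0 = 0 \<and>
     LL_equiv scale (r + r' + LL_times r r') 0 \<and> LL_equiv scale (r' + r + LL_times r' r) 0"

definition is_TT_inverse ::
    "('k::field \<Rightarrow> 'a::ring \<Rightarrow> 'a) \<Rightarrow>
     ('a list \<times> 'a list \<Rightarrow>\<^sub>0 'k) fps \<Rightarrow> ('a list \<times> 'a list \<Rightarrow>\<^sub>0 'k) fps \<Rightarrow> bool" where
  "is_TT_inverse scale p q \<longleftrightarrow>
     TT_equiv scale (TT_times p q) TT_one \<and> TT_equiv scale (TT_times q p) TT_one"


section \<open>Well-definedness on the quotients\<close>

subsection \<open>Linear extensions\<close>

lemma lin_ext_superset:
  assumes "finite A" "Poly_Mapping.keys p \<subseteq> A"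
  shows "lin_ext f p = (\<Sum>x\<in>A. fscale (Poly_Mapping.lookup p x) (f x))"
  unfolding lin_ext_def using assms
  by (intro sum.mono_neutral_left) (auto simp: in_keys_iff)

lemma lin_ext_add: "lin_ext f (p + q) = lin_ext f p + lin_ext f q"
proof -
  let ?A = "Poly_Mapping.keys p \<union> Poly_Mapping.keys q"
  have "Poly_Mapping.keys (p + q) \<subseteq> ?A" by (rule Poly_Mapping.keys_add)
  then show ?thesis
    by (simp add: lin_ext_superset[of ?A] lookup_add free.scale_left_distrib sum.distrib)
qed

lemma lin_ext_fscale: "lin_ext f (fscale c p) = fscale c (lin_ext f p)"
proof -
  have "Poly_Mapping.keys (fscale c p) \<subseteq> Poly_Mapping.keys p" by (auto simp: in_keys_iff)
  then show ?thesis
    by (simp add: lin_ext_superset[of "Poly_Mapping.keys p"] free.scale_sum_right)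
qed

lemma lin_ext_0 [simp]: "lin_ext f 0 = 0"
  by (simp add: lin_ext_def)

lemma lin_ext_diff: "lin_ext f (p - q) = lin_ext f p - lin_ext f q"
  using lin_ext_add[of f "p - q" q] by (simp add: algebra_simps)

lemma lin_ext_sum: "lin_ext f (sum g A) = (\<Sum>a\<in>A. lin_ext f (g a))"
  by (induction A rule: infinite_finite_induct) (auto simp: lin_ext_add)

lemma lin_ext_gen [simp]: "lin_ext f (gen x) = f x"
  by (simp add: lin_ext_def)

lemma lin_ext_in:
  assumes "free.subspace T" "\<And>x. f x \<in> T"
  shows "lin_ext f p \<in> T"
  unfolding lin_ext_def using assms by (intro free.subspace_sum free.subspace_scale) auto

lemma lin_ext_lin_ext: "lin_ext g (lin_ext f p) = lin_ext (\<lambda>x. lin_ext g (f x)) p"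
  by (simp add: lin_ext_def[of f p] lin_ext_def[of "\<lambda>x. lin_ext g (f x)" p] lin_ext_sum lin_ext_fscale)

lemma lin_ext_fun_sum: "lin_ext (\<lambda>x. \<Sum>a\<in>A. f a x) p = (\<Sum>a\<in>A. lin_ext (f a) p)"
  unfolding lin_ext_def by (simp add: free.scale_sum_right) (rule sum.swap)

lemma lin_ext_swap:
  "lin_ext (\<lambda>x. lin_ext (f x) q) p = lin_ext (\<lambda>y. lin_ext (\<lambda>x. f x y) p) q"
  unfolding lin_ext_def
  by (simp add: free.scale_sum_right mult.commute) (rule sum.swap)

lemma lin_ext_span:
  assumes "p \<in> free.span B" "free.subspace T" "\<And>b. b \<in> B \<Longrightarrow> lin_ext f b \<in> T"
  shows "lin_ext f p \<in> T"
proof -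
  have "free.subspace {p. lin_ext f p \<in> T}"
    using assms(2)
    by (auto simp: free.subspace_def lin_ext_add lin_ext_fscale)
  with assms(1,3) have "p \<in> {p. lin_ext f p \<in> T}"
    by (metis (mono_tags, lifting) free.span_minimal mem_Collect_eq subset_iff)
  then show ?thesis by simp
qed

lemma tensor_gen_right: "tensor p (gen y) = lin_ext (\<lambda>x. gen (x, y)) p"
  by (simp add: tensor_def bilin_ext_def)

lemma tensor_gen_left: "tensor (gen x) q = lin_ext (\<lambda>y. gen (x, y)) q"
  by (simp add: tensor_def bilin_ext_def)

lemma tensor_lin_ext_left: "tensor (lin_ext f p) q = lin_ext (\<lambda>x. tensor (f x) q) p"
  by (simp add: tensor_def bilin_ext_def lin_ext_lin_ext)

lemma tensor_lin_ext_right: "tensor p (lin_ext f q) = lin_ext (\<lambda>y. tensor p (f y)) q"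
proof -
  have "tensor p (lin_ext f q) = lin_ext (\<lambda>x. lin_ext (\<lambda>y. lin_ext (\<lambda>y'. gen (x, y')) (f y)) q) p"
    by (simp add: tensor_def bilin_ext_def lin_ext_lin_ext)
  also have "\<dots> = lin_ext (\<lambda>y. tensor p (f y)) q"
    by (subst lin_ext_swap) (simp add: tensor_def bilin_ext_def)
  finally show ?thesis .
qed

lemma subspace_rels [simp]:
  "free.subspace (lin_rel scale)" "free.subspace (multilin_rel scale)"
  "free.subspace (tensor_rel R S)"
  by (simp_all add: lin_rel_def multilin_rel_def tensor_rel_def)

lemma tensor_in_left: 
  assumes "p \<in> R" shows "tensor p q \<in> tensor_rel R S"
proof -
  have "tensor p (gen y) \<in> tensor_rel R S" for y
    unfolding tensor_rel_def using assms by (intro free.span_base) auto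
  moreover have "tensor p q = lin_ext (\<lambda>y. tensor p (gen y)) q"
    by (simp add: tensor_def bilin_ext_def) (rule lin_ext_swap)
  ultimately show ?thesis by (simp add: lin_ext_in)
qed

lemma tensor_in_right: 
  assumes "q \<in> S" shows "tensor p q \<in> tensor_rel R S"
proof -
  have "tensor (gen x) q \<in> tensor_rel R S" for x
    unfolding tensor_rel_def using assms by (intro free.span_base) auto
  moreover have "tensor p q = lin_ext (\<lambda>x. tensor (gen x) q) p"
    by (simp add: tensor_def bilin_ext_def)
  ultimately show ?thesis by (simp add: lin_ext_in)
qed


subsection \<open>Bilinear maps\<close>

definition descends where
  "descends f R S T \<longleftrightarrow>
     (\<forall>p\<in>R. \<forall>y. lin_ext (\<lambda>x. f x y) p \<in> T) \<and> (\<forall>q\<in>S. \<forall>x. lin_ext (f x) q \<in> T)"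

lemma descends_flip: "descends f R S T \<Longrightarrow> descends (\<lambda>y x. f x y) S R T"
  by (auto simp: descends_def)

lemma bilin_ext_well_defined:
  assumes "descends f R S T" "free.subspace T" "p - p' \<in> R" "q - q' \<in> S"
  shows "bilin_ext f p q - bilin_ext f p' q' \<in> T"
proof -
  have sw: "bilin_ext f p q = lin_ext (\<lambda>y. lin_ext (\<lambda>x. f x y) p) q" for p q
    unfolding bilin_ext_def by (rule lin_ext_swap)
  have "bilin_ext f (p - p') q \<in> T"
    unfolding sw by (rule lin_ext_in[OF assms(2)]) (use assms(1,3) in \<open>simp add: descends_def\<close>)
  moreover have "bilin_ext f p' (q - q') \<in> T"
    unfolding bilin_ext_def by (rule lin_ext_in[OF assms(2)]) (use assms(1,4) in \<open>simp add: descends_def\<close>)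
  moreover have "bilin_ext f (p - p') q = bilin_ext f p q - bilin_ext f p' q"
    by (simp add: bilin_ext_def lin_ext_diff)
  moreover have "bilin_ext f p' (q - q') = bilin_ext f p' q - bilin_ext f p' q'"
    by (simp add: sw lin_ext_diff)
  ultimately have "(bilin_ext f p q - bilin_ext f p' q) + (bilin_ext f p' q - bilin_ext f p' q') \<in> T"
    using assms(2) free.subspace_add by metis
  then show ?thesis by simp
qed

lemma tensor_mul_descends:
  assumes "descends f R R' R''" "descends g S S' S''"
  shows "descends (tensor_mul f g) (tensor_rel R S) (tensor_rel R' S') (tensor_rel R'' S'')"
proof -
  have "lin_ext (\<lambda>x. tensor_mul f g x y) p \<in> tensor_rel R'' S''"
    if "p \<in> tensor_rel R S" for p y
    using that unfolding tensor_rel_def[of R S]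
  proof (rule lin_ext_span)
    obtain a b where y: "y = (a, b)" by (cases y)
    fix t assume "t \<in> {tensor p (gen y) |p y. p \<in> R} \<union> {tensor (gen x) q |x q. q \<in> S}"
    then consider p c where "p \<in> R" "t = tensor p (gen c)" | q c where "q \<in> S" "t = tensor (gen c) q"
      by blast
    then show "lin_ext (\<lambda>x. tensor_mul f g x y) t \<in> tensor_rel R'' S''"
    proof cases
      case 1
      have "lin_ext (\<lambda>x. tensor_mul f g x y) t = tensor (lin_ext (\<lambda>x. f x a) p) (g c b)"
        by (simp add: 1 y tensor_gen_right lin_ext_lin_ext tensor_mul_def tensor_lin_ext_left)
      then show ?thesis using assms 1 by (auto simp: descends_def intro!: tensor_in_left)
    next
      case 2
      have "lin_ext (\<lambda>x. tensor_mul f g x y) t = tensor (f c a) (lin_ext (\<lambda>x. g x b) q)"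
        by (simp add: 2 y tensor_gen_left lin_ext_lin_ext tensor_mul_def tensor_lin_ext_right)
      then show ?thesis using assms 2 by (auto simp: descends_def intro!: tensor_in_right)
    qed
  qed simp
  moreover have "lin_ext (tensor_mul f g x) q \<in> tensor_rel R'' S''"
    if "q \<in> tensor_rel R' S'" for q x
    using that unfolding tensor_rel_def[of R' S']
  proof (rule lin_ext_span)
    obtain a b where x: "x = (a, b)" by (cases x)
    fix t assume "t \<in> {tensor p (gen y) |p y. p \<in> R'} \<union> {tensor (gen x) q |x q. q \<in> S'}"
    then consider p c where "p \<in> R'" "t = tensor p (gen c)" | q c where "q \<in> S'" "t = tensor (gen c) q"
      by blast
    then show "lin_ext (tensor_mul f g x) t \<in> tensor_rel R'' S''"
    proof cases
      case 1
      have "lin_ext (tensor_mul f g x) t = tensor (lin_ext (f a) p) (g b c)"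
        by (simp add: 1 x tensor_gen_right lin_ext_lin_ext tensor_mul_def tensor_lin_ext_left)
      then show ?thesis using assms 1 by (auto simp: descends_def intro!: tensor_in_left)
    next
      case 2
      have "lin_ext (tensor_mul f g x) t = tensor (f a c) (lin_ext (g b) q)"
        by (simp add: 2 x tensor_gen_left lin_ext_lin_ext tensor_mul_def tensor_lin_ext_right)
      then show ?thesis using assms 2 by (auto simp: descends_def intro!: tensor_in_right)
    qed
  qed simp
  ultimately show ?thesis by (auto simp: descends_def)
qed

lemma word_in_multilin_rel:
  "p \<in> lin_rel scale \<Longrightarrow> lin_ext (\<lambda>z. gen (u @ z # v)) p \<in> multilin_rel scale"
  unfolding multilin_rel_def by (intro free.span_base) auto

lemma snoc_descends: "descends snoc (multilin_rel scale) (lin_rel scale) (multilin_rel scale)"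
proof -
  have "lin_ext (\<lambda>w. snoc w x) p \<in> multilin_rel scale" if "p \<in> multilin_rel scale" for p x
    using that unfolding multilin_rel_def[of scale]
  proof (rule lin_ext_span)
    fix t assume "t \<in> {lin_ext (\<lambda>z. gen (u @ z # v)) p |u v p. p \<in> lin_rel scale}"
    then obtain u v p where "p \<in> lin_rel scale" "t = lin_ext (\<lambda>z. gen (u @ z # v)) p" by blast
    then show "lin_ext (\<lambda>w. snoc w x) t
        \<in> free.span {lin_ext (\<lambda>z. gen (u @ z # v)) p |u v p. p \<in> lin_rel scale}"
      using word_in_multilin_rel[of p scale u "v @ [x]"]
      by (simp add: lin_ext_lin_ext snoc_def multilin_rel_def)
  qed simp
  moreover have "lin_ext (snoc w) q \<in> multilin_rel scale" if "q \<in> lin_rel scale" for q w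
    using word_in_multilin_rel[OF that, of w "[]"] by (simp add: snoc_def[abs_def])
  ultimately show ?thesis by (auto simp: descends_def)
qed

context fin_dim_algebra
begin

lemma L_mul_descends: "descends L_mul (lin_rel scale) (lin_rel scale) (lin_rel scale)"
proof -
  have add: "gen (a + b) - gen a - gen b \<in> lin_rel scale" for a b
    unfolding lin_rel_def by (intro free.span_base) auto
  have scl: "gen (scale c a) - fscale c (gen a) \<in> lin_rel scale" for c a
    unfolding lin_rel_def by (intro free.span_base) auto
  have "lin_ext (\<lambda>x. L_mul x y) p \<in> lin_rel scale" if "p \<in> lin_rel scale" for p y
    using that unfolding lin_rel_def[of scale]
  proof (rule lin_ext_span)
    fix t assume "t \<in> {gen (x + y) - gen x - gen y |x y. True} \<union>
      {gen (scale c x) - fscale c (gen x) |c x. True}"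
    then have "lin_ext (\<lambda>x. L_mul x y) t \<in> lin_rel scale"
      using add scl
      by (auto simp: lin_ext_diff lin_ext_fscale L_mul_def distrib_right scale_mult_left[symmetric])
    then show "lin_ext (\<lambda>x. L_mul x y) t \<in> free.span ({gen (x + y) - gen x - gen y |x y. True} \<union>
      {gen (scale c x) - fscale c (gen x) |c x. True})" by (simp add: lin_rel_def)
  qed simp
  moreover have "lin_ext (L_mul x) q \<in> lin_rel scale" if "q \<in> lin_rel scale" for q x
    using that unfolding lin_rel_def[of scale]
  proof (rule lin_ext_span)
    fix t assume "t \<in> {gen (x + y) - gen x - gen y |x y. True} \<union>
      {gen (scale c x) - fscale c (gen x) |c x. True}"
    then have "lin_ext (L_mul x) t \<in> lin_rel scale"
      using add scl
      by (auto simp: lin_ext_diff lin_ext_fscale L_mul_def distrib_left scale_mult_right[symmetric])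
    then show "lin_ext (L_mul x) t \<in> free.span ({gen (x + y) - gen x - gen y |x y. True} \<union>
      {gen (scale c x) - fscale c (gen x) |c x. True})" by (simp add: lin_rel_def)
  qed simp
  ultimately show ?thesis by (auto simp: descends_def)
qed

end

lemma place_unique:
  assumes "finite A" "p < card A"
  obtains i where "i \<in> A" "\<And>j. j \<in> A \<Longrightarrow> card {k \<in> A. k < j} = p \<longleftrightarrow> j = (i::nat)"
proof -
  let ?g = "\<lambda>i. card {k \<in> A. k < i}"
  have less: "?g i < ?g j" if "i \<in> A" "j \<in> A" "i < j" for i j
  proof (rule psubset_card_mono)
    show "finite {k \<in> A. k < j}" using assms(1) by simp
    have "{k \<in> A. k < i} \<subseteq> {k \<in> A. k < j}" using that(3) by fastforce
    moreover have "i \<in> {k \<in> A. k < j}" "i \<notin> {k \<in> A. k < i}" using that by simp_all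
    ultimately show "{k \<in> A. k < i} \<subset> {k \<in> A. k < j}" by blast
  qed
  have inj: "inj_on ?g A"
  proof (rule inj_onI)
    fix i j assume "i \<in> A" "j \<in> A" "?g i = ?g j"
    then show "i = j" using less[of i j] less[of j i] by (cases i j rule: linorder_cases) simp_all
  qed
  have "?g j < card A" if "j \<in> A" for j
    using assms(1) that by (intro psubset_card_mono) blast+
  then have "?g ` A = {..<card A}"
    by (intro card_subset_eq) (auto simp: card_image inj)
  then have "p \<in> ?g ` A" using assms(2) by simp
  then obtain i where i: "i \<in> A" "?g i = p" by blast
  have "?g j = p \<longleftrightarrow> j = i" if "j \<in> A" for j
    using inj_on_eq_iff[OF inj that i(1)] i(2) by simp
  with i(1) show ?thesis by (rule that)
qed

lemma ito_word_letter_left: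
  assumes "A \<union> B = {..<n}" "card A = length (u1 @ z0 # u2)"
  obtains s t b where
    "(\<forall>z. ito_word A B n (u1 @ z # u2) w = s @ z # t) \<or>
     (\<forall>z. ito_word A B n (u1 @ z # u2) w = s @ (z * b) # t)"
proof -
  have "finite A" using assms(1) by (metis finite_Un finite_lessThan)
  then obtain i where i: "i \<in> A" "\<And>j. j \<in> A \<Longrightarrow> card {k \<in> A. k < j} = length u1 \<longleftrightarrow> j = i"
    using place_unique[of A "length u1"] assms(2) by auto
  have lt: "i < n" using i(1) assms(1) by blast
  let ?W = "\<lambda>z. ito_word A B n (u1 @ z # u2) w"
  have at: "place_letter A (u1 @ z # u2) i = z" for z
    using i(2)[OF i(1)] by (simp add: place_letter_def)
  have off: "place_letter A (u1 @ z # u2) j = place_letter A (u1 @ z' # u2) j" if "j \<in> A" "j \<noteq> i" for j z z'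
    using i that by (auto simp: place_letter_def nth_append nth_Cons split: nat.splits)
  have W: "?W z = take i (?W z0) @ (?W z ! i) # drop (Suc i) (?W z0)" for z
  proof -
    have len: "length (?W z) = n" for z by (simp add: ito_word_def)
    have "?W z ! j = (?W z0)[i := ?W z ! i] ! j" if "j < n" for j
    proof (cases "j = i")
      case False
      then have "?W z ! j = ?W z0 ! j"
        using that off[of j z z0] by (auto simp: ito_word_def)
      then show ?thesis using False by simp
    qed (simp add: len lt)
    then have "?W z = (?W z0)[i := ?W z ! i]" by (intro nth_equalityI) (auto simp: len)
    then show ?thesis using lt by (metis upd_conv_take_nth_drop len)
  qed
  show ?thesis
  proof (cases "i \<in> B")
    case True
    then have e: "?W z ! i = z * place_letter B w i" for z
      using i(1) lt at by (simp add: ito_word_def)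
    have "\<forall>z. ?W z = take i (?W z0) @ (z * place_letter B w i) # drop (Suc i) (?W z0)"
    proof
      fix z show "?W z = take i (?W z0) @ (z * place_letter B w i) # drop (Suc i) (?W z0)"
        using W[of z] unfolding e .
    qed
    then show ?thesis by (intro that disjI2)
  next
    case False
    then have e: "?W z ! i = z" for z
      using i(1) lt at by (simp add: ito_word_def)
    have "\<forall>z. ?W z = take i (?W z0) @ z # drop (Suc i) (?W z0)"
    proof
      fix z show "?W z = take i (?W z0) @ z # drop (Suc i) (?W z0)"
        using W[of z] unfolding e .
    qed
    then show ?thesis by (intro that disjI1)
  qed
qed

lemma ito_word_letter_right:
  assumes "A \<union> B = {..<n}" "card B = length (u1 @ z0 # u2)"
  obtains s t b where
    "(\<forall>z. ito_word A B n w (u1 @ z # u2) = s @ z # t) \<or>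
     (\<forall>z. ito_word A B n w (u1 @ z # u2) = s @ (b * z) # t)"
proof -
  have "finite B" using assms(1) by (metis finite_Un finite_lessThan)
  then obtain i where i: "i \<in> B" "\<And>j. j \<in> B \<Longrightarrow> card {k \<in> B. k < j} = length u1 \<longleftrightarrow> j = i"
    using place_unique[of B "length u1"] assms(2) by auto
  have lt: "i < n" using i(1) assms(1) by blast
  let ?W = "\<lambda>z. ito_word A B n w (u1 @ z # u2)"
  have at: "place_letter B (u1 @ z # u2) i = z" for z
    using i(2)[OF i(1)] by (simp add: place_letter_def)
  have off: "place_letter B (u1 @ z # u2) j = place_letter B (u1 @ z' # u2) j" if "j \<in> B" "j \<noteq> i" for j z z'
    using i that by (auto simp: place_letter_def nth_append nth_Cons split: nat.splits)
  have W: "?W z = take i (?W z0) @ (?W z ! i) # drop (Suc i) (?W z0)" for z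
  proof -
    have len: "length (?W z) = n" for z by (simp add: ito_word_def)
    have "?W z ! j = (?W z0)[i := ?W z ! i] ! j" if "j < n" for j
    proof (cases "j = i")
      case False
      moreover have "j \<in> A \<or> j \<in> B" using that assms(1) by blast
      ultimately have "?W z ! j = ?W z0 ! j"
        using that off[of j z z0] by (auto simp: ito_word_def)
      then show ?thesis using False by simp
    qed (simp add: len lt)
    then have "?W z = (?W z0)[i := ?W z ! i]" by (intro nth_equalityI) (auto simp: len)
    then show ?thesis using lt by (metis upd_conv_take_nth_drop len)
  qed
  show ?thesis
  proof (cases "i \<in> A")
    case True
    then have e: "?W z ! i = place_letter A w i * z" for z
      using i(1) lt at by (simp add: ito_word_def)
    have "\<forall>z. ?W z = take i (?W z0) @ (place_letter A w i * z) # drop (Suc i) (?W z0)"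
    proof
      fix z show "?W z = take i (?W z0) @ (place_letter A w i * z) # drop (Suc i) (?W z0)"
        using W[of z] unfolding e .
    qed
    then show ?thesis by (intro that disjI2)
  next
    case False
    then have e: "?W z ! i = z" for z
      using i(1) lt at by (simp add: ito_word_def)
    have "\<forall>z. ?W z = take i (?W z0) @ z # drop (Suc i) (?W z0)"
    proof
      fix z show "?W z = take i (?W z0) @ z # drop (Suc i) (?W z0)"
        using W[of z] unfolding e .
    qed
    then show ?thesis by (intro that disjI1)
  qed
qed

context fin_dim_algebra
begin

lemma word_mult_in_multilin_rel:
  assumes "p \<in> lin_rel scale"
  shows "lin_ext (\<lambda>z. gen (s @ (z * b) # t)) p \<in> multilin_rel scale"
    and "lin_ext (\<lambda>z. gen (s @ (b * z) # t)) p \<in> multilin_rel scale"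
proof -
  have "lin_ext (\<lambda>z. gen (z * b)) p \<in> lin_rel scale" "lin_ext (\<lambda>z. gen (b * z)) p \<in> lin_rel scale"
    using L_mul_descends assms by (auto simp: descends_def L_mul_def[abs_def])
  from this[THEN word_in_multilin_rel, of s t]
  show "lin_ext (\<lambda>z. gen (s @ (z * b) # t)) p \<in> multilin_rel scale"
    and "lin_ext (\<lambda>z. gen (s @ (b * z) # t)) p \<in> multilin_rel scale"
    by (simp_all add: lin_ext_lin_ext)
qed

lemma ito_mul_descends: "descends ito_mul (multilin_rel scale) (multilin_rel scale) (multilin_rel scale)"
proof -
  have "lin_ext (\<lambda>u. ito_mul u w) t \<in> multilin_rel scale"
    "lin_ext (ito_mul w) t \<in> multilin_rel scale" if t: "t \<in> multilin_rel scale" for t w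
  proof -
    have summand_left: "lin_ext (\<lambda>z. gen (ito_word A B n (u @ z # v) w)) p \<in> multilin_rel scale"
      if p: "p \<in> lin_rel scale" and AB: "A \<union> B = {..<n}" "card A = Suc (length u + length v)"
      for p A B n u v
    proof -
      have "card A = length (u @ 0 # v)" using AB(2) by simp
      from ito_word_letter_left[OF AB(1) this, of w] obtain s t b where
        "(\<forall>z. ito_word A B n (u @ z # v) w = s @ z # t) \<or>
         (\<forall>z. ito_word A B n (u @ z # v) w = s @ (z * b) # t)" by blast
      then show ?thesis
        using word_in_multilin_rel[OF p] word_mult_in_multilin_rel[OF p] by (elim disjE) simp_all
    qed
    have summand_right: "lin_ext (\<lambda>z. gen (ito_word A B n w (u @ z # v))) p \<in> multilin_rel scale"
      if p: "p \<in> lin_rel scale" and AB: "A \<union> B = {..<n}" "card B = Suc (length u + length v)"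
      for p A B n u v
    proof -
      have "card B = length (u @ 0 # v)" using AB(2) by simp
      from ito_word_letter_right[OF AB(1) this, of w] obtain s t b where
        "(\<forall>z. ito_word A B n w (u @ z # v) = s @ z # t) \<or>
         (\<forall>z. ito_word A B n w (u @ z # v) = s @ (b * z) # t)" by blast
      then show ?thesis
        using word_in_multilin_rel[OF p] word_mult_in_multilin_rel[OF p] by (elim disjE) simp_all
    qed
    show "lin_ext (\<lambda>u. ito_mul u w) t \<in> multilin_rel scale"
      using t unfolding multilin_rel_def[of scale]
    proof (rule lin_ext_span)
      fix t assume "t \<in> {lin_ext (\<lambda>z. gen (u @ z # v)) p |u v p. p \<in> lin_rel scale}"
      then obtain u v p where p: "p \<in> lin_rel scale" and t: "t = lin_ext (\<lambda>z. gen (u @ z # v)) p"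
        by blast
      have "lin_ext (\<lambda>u. ito_mul u w) t \<in> multilin_rel scale"
        unfolding t lin_ext_lin_ext lin_ext_gen ito_mul_def length_append list.size(4)
          lin_ext_fun_sum case_prod_unfold
        by (intro free.subspace_sum subspace_rels summand_left p) auto
      then show "lin_ext (\<lambda>u. ito_mul u w) t
          \<in> free.span {lin_ext (\<lambda>z. gen (u @ z # v)) p |u v p. p \<in> lin_rel scale}"
        by (simp add: multilin_rel_def)
    qed simp
    show "lin_ext (ito_mul w) t \<in> multilin_rel scale"
      using t unfolding multilin_rel_def[of scale]
    proof (rule lin_ext_span)
      fix t assume "t \<in> {lin_ext (\<lambda>z. gen (u @ z # v)) p |u v p. p \<in> lin_rel scale}"
      then obtain u v p where p: "p \<in> lin_rel scale" and t: "t = lin_ext (\<lambda>z. gen (u @ z # v)) p"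
        by blast
      have "lin_ext (ito_mul w) t \<in> multilin_rel scale"
        unfolding t lin_ext_lin_ext lin_ext_gen ito_mul_def length_append list.size(4)
          lin_ext_fun_sum case_prod_unfold
        by (intro free.subspace_sum subspace_rels summand_right p) auto
      then show "lin_ext (ito_mul w) t
          \<in> free.span {lin_ext (\<lambda>z. gen (u @ z # v)) p |u v p. p \<in> lin_rel scale}"
        by (simp add: multilin_rel_def)
    qed simp
  qed
  then show ?thesis by (auto simp: descends_def)
qed

end


subsection \<open>Power series and product integrals\<close>

lemma fps_bilin_well_defined:
  assumes "descends f R S T" "free.subspace T" "fps_equiv R p p'" "fps_equiv S q q'"
  shows "fps_equiv T (fps_bilin f p q) (fps_bilin f p' q')"
  using assms(3,4) unfolding fps_equiv_def fps_bilin_def fps_nth_Abs_fps sum_subtractf[symmetric]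
  by (intro allI free.subspace_sum assms(2) bilin_ext_well_defined[OF assms(1,2)]) auto

lemma hsum_well_defined:
  assumes "free.subspace R" "\<And>n. fps_equiv R (t n) (t' n)"
  shows "fps_equiv R (hsum t) (hsum t')"
  using assms(2) unfolding fps_equiv_def hsum_def fps_nth_Abs_fps sum_subtractf[symmetric]
  by (intro allI free.subspace_sum assms(1)) auto

lemma left_term_0_well_defined:
  assumes "fps_equiv (tensor_rel R (lin_rel scale)) l l'"
  shows "fps_equiv (tensor_rel R (multilin_rel scale))
    (fps_lin (\<lambda>(a, x). gen (a, [x])) l) (fps_lin (\<lambda>(a, x). gen (a, [x])) l')"
proof -
  have "lin_ext (\<lambda>(a, x). gen (a, [x])) p \<in> tensor_rel R (multilin_rel scale)"
    if "p \<in> tensor_rel R (lin_rel scale)" for p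
    using that unfolding tensor_rel_def[of R "lin_rel scale"]
  proof (rule lin_ext_span)
    fix t assume "t \<in> {tensor p (gen y) |p y. p \<in> R} \<union> {tensor (gen x) q |x q. q \<in> lin_rel scale}"
    then consider p c where "p \<in> R" "t = tensor p (gen c)"
      | q c where "q \<in> lin_rel scale" "t = tensor (gen c) q" by blast
    then show "lin_ext (\<lambda>(a, x). gen (a, [x])) t \<in> tensor_rel R (multilin_rel scale)"
    proof cases
      case 1
      then show ?thesis using tensor_in_left[of p R "gen [c]"]
        by (simp add: tensor_gen_right lin_ext_lin_ext)
    next
      case 2
      have "lin_ext (\<lambda>(a, x). gen (a, [x])) t = tensor (gen c) (lin_ext (\<lambda>x. gen [x]) q)"
        by (simp add: 2 tensor_gen_left lin_ext_lin_ext)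
      then show ?thesis using tensor_in_right word_in_multilin_rel[OF 2(1), of "[]" "[]"] by simp
    qed
  qed simp
  then show ?thesis using assms by (simp add: fps_equiv_def fps_lin_def lin_ext_diff[symmetric])
qed

lemma right_term_0_well_defined:
  assumes "fps_equiv (tensor_rel (lin_rel scale) R) m m'"
  shows "fps_equiv (tensor_rel (multilin_rel scale) R)
    (fps_lin (\<lambda>(x, a). gen ([x], a)) m) (fps_lin (\<lambda>(x, a). gen ([x], a)) m')"
proof -
  have "lin_ext (\<lambda>(x, a). gen ([x], a)) p \<in> tensor_rel (multilin_rel scale) R"
    if "p \<in> tensor_rel (lin_rel scale) R" for p
    using that unfolding tensor_rel_def[of "lin_rel scale" R]
  proof (rule lin_ext_span)
    fix t assume "t \<in> {tensor p (gen y) |p y. p \<in> lin_rel scale} \<union> {tensor (gen x) q |x q. q \<in> R}"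
    then consider p c where "p \<in> lin_rel scale" "t = tensor p (gen c)"
      | q c where "q \<in> R" "t = tensor (gen c) q" by blast
    then show "lin_ext (\<lambda>(x, a). gen ([x], a)) t \<in> tensor_rel (multilin_rel scale) R"
    proof cases
      case 1
      have "lin_ext (\<lambda>(x, a). gen ([x], a)) t = tensor (lin_ext (\<lambda>x. gen [x]) p) (gen c)"
        by (simp add: 1 tensor_gen_right lin_ext_lin_ext)
      then show ?thesis using tensor_in_left word_in_multilin_rel[OF 1(1), of "[]" "[]"] by simp
    next
      case 2
      then show ?thesis using tensor_in_right[of q R "gen [c]"]
        by (simp add: tensor_gen_left lin_ext_lin_ext)
    qed
  qed simp
  then show ?thesis using assms by (simp add: fps_equiv_def fps_lin_def lin_ext_diff[symmetric])
qed

lemma left_hat_well_defined: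
  assumes "descends f R R R" "fps_equiv (tensor_rel R (lin_rel scale)) l l'"
  shows "fps_equiv (tensor_rel R (multilin_rel scale)) (left_fwd_hat f l) (left_fwd_hat f l')"
    and "fps_equiv (tensor_rel R (multilin_rel scale)) (left_bwd_hat f l) (left_bwd_hat f l')"
proof -
  note * = tensor_mul_descends[OF assms(1) snoc_descends[of scale]]
    tensor_mul_descends[OF assms(1) descends_flip[OF snoc_descends[of scale]]]
  have "fps_equiv (tensor_rel R (multilin_rel scale)) (left_fwd_term f l n) (left_fwd_term f l' n)"
    "fps_equiv (tensor_rel R (multilin_rel scale)) (left_bwd_term f l n) (left_bwd_term f l' n)" for n
    by (induction n) (auto intro: left_term_0_well_defined fps_bilin_well_defined * assms)
  then show "fps_equiv (tensor_rel R (multilin_rel scale)) (left_fwd_hat f l) (left_fwd_hat f l')"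
    and "fps_equiv (tensor_rel R (multilin_rel scale)) (left_bwd_hat f l) (left_bwd_hat f l')"
    by (simp_all add: left_fwd_hat_def left_bwd_hat_def hsum_well_defined)
qed

lemma right_hat_well_defined:
  assumes "descends f R R R" "fps_equiv (tensor_rel (lin_rel scale) R) m m'"
  shows "fps_equiv (tensor_rel (multilin_rel scale) R) (right_fwd_hat f m) (right_fwd_hat f m')"
    and "fps_equiv (tensor_rel (multilin_rel scale) R) (right_bwd_hat f m) (right_bwd_hat f m')"
proof -
  note * = tensor_mul_descends[OF snoc_descends[of scale] assms(1)]
    tensor_mul_descends[OF descends_flip[OF snoc_descends[of scale]] assms(1)]
  have "fps_equiv (tensor_rel (multilin_rel scale) R) (right_fwd_term f m n) (right_fwd_term f m' n)"
    "fps_equiv (tensor_rel (multilin_rel scale) R) (right_bwd_term f m n) (right_bwd_term f m' n)" for n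
    by (induction n) (auto intro: right_term_0_well_defined fps_bilin_well_defined * assms)
  then show "fps_equiv (tensor_rel (multilin_rel scale) R) (right_fwd_hat f m) (right_fwd_hat f m')"
    and "fps_equiv (tensor_rel (multilin_rel scale) R) (right_bwd_hat f m) (right_bwd_hat f m')"
    by (simp_all add: right_fwd_hat_def right_bwd_hat_def hsum_well_defined)
qed

context fin_dim_algebra
begin

lemma LL_times_well_defined:
  "LL_equiv scale p p' \<Longrightarrow> LL_equiv scale q q' \<Longrightarrow> LL_equiv scale (LL_times p q) (LL_times p' q')"
  unfolding LL_times_def
  by (rule fps_bilin_well_defined[OF tensor_mul_descends[OF L_mul_descends L_mul_descends]]) auto

lemma TT_times_well_defined:
  "TT_equiv scale p p' \<Longrightarrow> TT_equiv scale q q' \<Longrightarrow> TT_equiv scale (TT_times p q) (TT_times p' q')"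
  unfolding TT_times_def
  by (rule fps_bilin_well_defined[OF tensor_mul_descends[OF ito_mul_descends ito_mul_descends]]) auto

lemma double_well_defined:
  assumes "LL_equiv scale r r'"
  shows "TT_equiv scale (double_fwd_bwd r) (double_fwd_bwd r')"
    and "TT_equiv scale (double_bwd_fwd r) (double_bwd_fwd r')"
  using left_hat_well_defined[OF ito_mul_descends right_hat_well_defined(2)[OF L_mul_descends assms]]
    left_hat_well_defined[OF ito_mul_descends right_hat_well_defined(1)[OF L_mul_descends assms]]
  by (simp_all add: double_fwd_bwd_def double_bwd_fwd_def fps_equiv_def)

end

end

theory Submission
  imports Defs
begin

text \<open>
  All identities are proved for the representatives in the free spaces; the quotient only enters
  through the fact that every quasiinverse is equivalent to the one given by the geometric series.

  Write \<open>P\<close> and \<open>Q\<close> for the decapitated product integrals of \<open>l\<close> (forward) and \<open>l'\<close> (backward).  If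
  the terms of the Ito product are sorted by the origin of the last letter, then the new factors meet
  in the middle, and \<open>(1 + P) (1 + Q) - 1\<close> becomes \<open>(1 + P) (l + l' + l l') (1 + Q)\<close>, which vanishes
  if \<open>l + l' + l l' = 0\<close>.  Applied first with \<open>L\<close> and then with \<open>T(L)\<close> as system algebra this gives
  one-sided inverses.  They are two-sided because series without constant term form a group under
  the circle operation \<open>p + q + p q\<close>.
\<close>

section \<open>Bilinear extensions\<close>

lemma lin_ext_fun_add: "lin_ext (\<lambda>x. f x + g x) p = lin_ext f p + lin_ext g p"
  by (simp add: lin_ext_def free.scale_right_distrib sum.distrib)

lemma lin_ext_fun_0 [simp]: "lin_ext (\<lambda>x. 0) p = 0"
  by (simp add: lin_ext_def)

lemma lin_ext_gen_id [simp]: "lin_ext gen p = p"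
proof (rule poly_mapping_eqI)
  fix x
  have "Poly_Mapping.lookup (lin_ext gen p) x =
      (\<Sum>y\<in>Poly_Mapping.keys p. if y = x then Poly_Mapping.lookup p y else 0)"
    unfolding lin_ext_def lookup_sum
    by (intro sum.cong) (auto simp: lookup_single when_def)
  then show "Poly_Mapping.lookup (lin_ext gen p) x = Poly_Mapping.lookup p x"
    by (simp add: in_keys_iff)
qed

lemma bilin_ext_flip: "bilin_ext (\<lambda>y x. f x y) q p = bilin_ext f p q"
  unfolding bilin_ext_def by (rule lin_ext_swap)

lemma bilin_ext_add_left: "bilin_ext f (p + p') q = bilin_ext f p q + bilin_ext f p' q"
  by (simp add: bilin_ext_def lin_ext_add)

lemma bilin_ext_add_right: "bilin_ext f p (q + q') = bilin_ext f p q + bilin_ext f p q'"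
  by (simp add: bilin_ext_def lin_ext_add lin_ext_fun_add)

lemma bilin_ext_0 [simp]: "bilin_ext f 0 q = 0" "bilin_ext f p 0 = 0"
  by (simp_all add: bilin_ext_def)

lemma bilin_ext_sum_left: "bilin_ext f (sum g A) q = (\<Sum>a\<in>A. bilin_ext f (g a) q)"
  by (simp add: bilin_ext_def lin_ext_sum)

lemma bilin_ext_sum_right: "bilin_ext f p (sum g A) = (\<Sum>a\<in>A. bilin_ext f p (g a))"
  by (simp add: bilin_ext_def lin_ext_sum lin_ext_fun_sum)

lemma bilin_ext_fun_add:
  "bilin_ext (\<lambda>x y. f x y + g x y) p q = bilin_ext f p q + bilin_ext g p q"
  by (simp add: bilin_ext_def lin_ext_fun_add)

lemma bilin_ext_gen [simp]: "bilin_ext f (gen x) q = lin_ext (f x) q"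
  by (simp add: bilin_ext_def)

lemma bilin_ext_gen_right: "bilin_ext f p (gen y) = lin_ext (\<lambda>x. f x y) p"
  by (simp add: bilin_ext_def)

lemma tensor_gen_gen [simp]: "tensor (gen x) (gen y) = gen (x, y)"
  by (simp add: tensor_def)

lemma tensor_add_right: "tensor p (q + q') = tensor p q + tensor p q'"
  by (simp add: tensor_def bilin_ext_add_right)

lemma tensor_0_right [simp]: "tensor p 0 = 0"
  by (simp add: tensor_def)

lemma lin_ext_tensor: "lin_ext h (tensor p q) = lin_ext (\<lambda>x. lin_ext (\<lambda>y. h (x, y)) q) p"
  by (simp add: tensor_def bilin_ext_def lin_ext_lin_ext)

lemma tensor_lin_ext_both:
  "tensor (lin_ext f p) (lin_ext g q) = lin_ext (\<lambda>x. lin_ext (\<lambda>y. tensor (f x) (g y)) q) p"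
  by (subst lin_ext_swap) (simp add: tensor_lin_ext_left tensor_lin_ext_right)

lemma tensor_mul_Pair [simp]: "tensor_mul f g (a, b) (c, d) = tensor (f a c) (g b d)"
  by (simp add: tensor_mul_def)

lemma lin_ext_tensor_mul_right:
  "lin_ext (tensor_mul f g (x, y)) (tensor p q) = tensor (lin_ext (f x) p) (lin_ext (g y) q)"
  by (simp add: lin_ext_tensor tensor_lin_ext_both)

lemma lin_ext_tensor_mul_left:
  "lin_ext (\<lambda>w. tensor_mul f g w (x, y)) (tensor p q) =
     tensor (lin_ext (\<lambda>w. f w x) p) (lin_ext (\<lambda>w. g w y) q)"
  by (simp add: lin_ext_tensor tensor_lin_ext_both)

text \<open>
  The mixed associativity law \<open>(x \<cdot>\<^bsub>g\<^esub> y) \<cdot>\<^bsub>f\<^esub> z = x \<cdot>\<^bsub>f'\<^esub> (y \<cdot>\<^bsub>g'\<^esub> z)\<close>.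
\<close>

definition assoc_maps ::
    "('w \<Rightarrow> 'z \<Rightarrow> ('t \<Rightarrow>\<^sub>0 'k::field)) \<Rightarrow> ('x \<Rightarrow> 'y \<Rightarrow> ('w \<Rightarrow>\<^sub>0 'k)) \<Rightarrow>
     ('x \<Rightarrow> 'v \<Rightarrow> ('t \<Rightarrow>\<^sub>0 'k)) \<Rightarrow> ('y \<Rightarrow> 'z \<Rightarrow> ('v \<Rightarrow>\<^sub>0 'k)) \<Rightarrow> bool" where
  "assoc_maps f g f' g' \<longleftrightarrow> (\<forall>x y z. lin_ext (\<lambda>w. f w z) (g x y) = lin_ext (f' x) (g' y z))"

abbreviation assoc_mul :: "('x \<Rightarrow> 'x \<Rightarrow> ('x \<Rightarrow>\<^sub>0 'k::field)) \<Rightarrow> bool" where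
  "assoc_mul f \<equiv> assoc_maps f f f f"

lemma assoc_maps_tensor_mul:
  assumes "assoc_maps f g f' g'" "assoc_maps h k h' k'"
  shows "assoc_maps (tensor_mul f h) (tensor_mul g k) (tensor_mul f' h') (tensor_mul g' k')"
  using assms by (auto simp: assoc_maps_def lin_ext_tensor_mul_left lin_ext_tensor_mul_right)

lemma bilin_ext_assoc:
  assumes "assoc_maps f g f' g'"
  shows "bilin_ext f (bilin_ext g p q) r = bilin_ext f' p (bilin_ext g' q r)"
proof -
  have "lin_ext (\<lambda>w. lin_ext (f w) r) (g x y) = lin_ext (f' x) (lin_ext (g' y) r)" for x y
  proof -
    have "lin_ext (\<lambda>w. lin_ext (f w) r) (g x y) = lin_ext (\<lambda>z. lin_ext (\<lambda>w. f w z) (g x y)) r"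
      by (rule lin_ext_swap)
    also have "\<dots> = lin_ext (f' x) (lin_ext (g' y) r)"
      using assms by (simp add: assoc_maps_def lin_ext_lin_ext)
    finally show ?thesis .
  qed
  then show ?thesis by (simp add: bilin_ext_def lin_ext_lin_ext)
qed


section \<open>Power series\<close>

lemma fps_bilin_nth:
  "fps_nth (fps_bilin f p q) N = (\<Sum>i\<le>N. bilin_ext f (fps_nth p i) (fps_nth q (N - i)))"
  by (simp add: fps_bilin_def)

lemma fps_bilin_flip: "fps_bilin (\<lambda>y x. f x y) q p = fps_bilin f p q"
proof (rule fps_ext)
  fix N
  have "fps_nth (fps_bilin (\<lambda>y x. f x y) q p) N =
      (\<Sum>i\<le>N. bilin_ext f (fps_nth p (N - i)) (fps_nth q i))"
    by (simp add: fps_bilin_nth bilin_ext_flip[of f])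
  also have "\<dots> = (\<Sum>i\<le>N. bilin_ext f (fps_nth p i) (fps_nth q (N - i)))"
    by (rule sum.reindex_bij_witness[of _ "\<lambda>i. N - i" "\<lambda>i. N - i"]) auto
  finally show "fps_nth (fps_bilin (\<lambda>y x. f x y) q p) N = fps_nth (fps_bilin f p q) N"
    by (simp add: fps_bilin_nth)
qed

lemma fps_bilin_add_left: "fps_bilin f (p + p') q = fps_bilin f p q + fps_bilin f p' q"
  by (rule fps_ext) (simp add: fps_bilin_nth bilin_ext_add_left sum.distrib)

lemma fps_bilin_add_right: "fps_bilin f p (q + q') = fps_bilin f p q + fps_bilin f p q'"
  by (rule fps_ext) (simp add: fps_bilin_nth bilin_ext_add_right sum.distrib)

lemma fps_bilin_0 [simp]: "fps_bilin f 0 q = 0" "fps_bilin f p 0 = 0"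
  by (rule fps_ext; simp add: fps_bilin_nth)+

lemma fps_bilin_uminus_left: "fps_bilin f (- p) q = - fps_bilin f p q"
  using fps_bilin_add_left[of f p "- p" q] by (simp add: eq_neg_iff_add_eq_0 add.commute)

lemma fps_bilin_fun_add:
  "fps_bilin (\<lambda>x y. f x y + g x y) p q = fps_bilin f p q + fps_bilin g p q"
  by (rule fps_ext) (simp add: fps_bilin_nth bilin_ext_fun_add sum.distrib)

lemma fps_bilin_assoc:
  assumes "assoc_maps f g f' g'"
  shows "fps_bilin f (fps_bilin g p q) r = fps_bilin f' p (fps_bilin g' q r)"
proof (rule fps_ext)
  fix N
  let ?b = "\<lambda>i j k. bilin_ext f (bilin_ext g (fps_nth p i) (fps_nth q j)) (fps_nth r k)"
  have "fps_nth (fps_bilin f (fps_bilin g p q) r) N = (\<Sum>j=0..N. \<Sum>i=0..j. ?b i (j - i) (N - j))"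
    by (simp add: fps_bilin_nth bilin_ext_sum_left atLeast0AtMost)
  \<comment> \<open>\<open>fps_mult_assoc_lemma\<close> only rearranges sums over
    \<open>i + j + k = N\<close> in a commutative monoid, so it applies to coefficients that carry
    no ring product.\<close>
  also have "\<dots> = (\<Sum>j=0..N. \<Sum>i=0..N - j. ?b j i (N - j - i))"
    by (rule fps_mult_assoc_lemma)
  also have "\<dots> = fps_nth (fps_bilin f' p (fps_bilin g' q r)) N"
    by (simp add: fps_bilin_nth bilin_ext_sum_right atLeast0AtMost bilin_ext_assoc[OF assms])
  finally show "fps_nth (fps_bilin f (fps_bilin g p q) r) N =
    fps_nth (fps_bilin f' p (fps_bilin g' q r)) N" .
qed

lemma fps_lin_add: "fps_lin f (p + q) = fps_lin f p + fps_lin f q"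
  by (rule fps_ext) (simp add: fps_lin_def lin_ext_add)

lemma fps_lin_0 [simp]: "fps_lin f 0 = 0"
  by (rule fps_ext) (simp add: fps_lin_def)

lemma fps_lin_fps_lin: "fps_lin g (fps_lin f p) = fps_lin (\<lambda>x. lin_ext g (f x)) p"
  by (rule fps_ext) (simp add: fps_lin_def lin_ext_lin_ext)

lemma fps_lin_gen [simp]: "fps_lin gen p = p"
  by (rule fps_ext) (simp add: fps_lin_def)

lemma fps_lin_fps_bilin: "fps_lin g (fps_bilin f p q) = fps_bilin (\<lambda>x y. lin_ext g (f x y)) p q"
  by (rule fps_ext) (simp add: fps_lin_def fps_bilin_nth bilin_ext_def lin_ext_lin_ext lin_ext_sum)

lemma fps_bilin_fps_lin_right:
  "fps_bilin f p (fps_lin g q) = fps_bilin (\<lambda>x y. lin_ext (f x) (g y)) p q"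
  by (rule fps_ext) (simp add: fps_lin_def fps_bilin_nth bilin_ext_def lin_ext_lin_ext)

lemma fps_bilin_fps_lin_left:
  "fps_bilin f (fps_lin g p) q = fps_bilin (\<lambda>x y. lin_ext (\<lambda>w. f w y) (g x)) p q"
  by (subst (1 2) fps_bilin_flip[symmetric]) (rule fps_bilin_fps_lin_right)

text \<open>The maps compared later are defined by matching on pairs and unfold only on explicit
  pairs; this rule supplies them.\<close>

lemma fps_bilin_cong_pair:
  "(\<And>a b c d. g (a, b) (c, d) = h (a, b) (c, d)) \<Longrightarrow> fps_bilin g p q = fps_bilin h p q"
  by (rule arg_cong[where f = "\<lambda>g. fps_bilin g p q"]) (auto simp: fun_eq_iff)

lemma fps_lin_cong_pair:
  "(\<And>a b. g (a, b) = h (a, b)) \<Longrightarrow> fps_lin g p = fps_lin h p"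
  by (rule arg_cong[where f = "\<lambda>g. fps_lin g p"]) (auto simp: fun_eq_iff)

lemma hsum_nth: "fps_nth (hsum t) N = (\<Sum>n<N. fps_nth (t n) N)"
  by (simp add: hsum_def)

lemma hsum_nth_0 [simp]: "fps_nth (hsum t) 0 = 0"
  by (simp add: hsum_nth)

lemma hsum_fps_lin: "fps_lin g (hsum t) = hsum (\<lambda>n. fps_lin g (t n))"
  by (rule fps_ext) (simp add: fps_lin_def hsum_nth lin_ext_sum)

text \<open>Each factor \<open>l\<close> raises the order in \<open>h\<close>, so \<open>t n\<close>
  vanishes up to and including order \<open>n\<close>. The truncation in \<open>hsum\<close>
  therefore loses nothing, and shifting the summation index by one pulls out a factor
  \<open>l\<close>.\<close>

lemma hsum_fixpoint:
  assumes "fps_nth l 0 = 0" "fps_nth (t 0) 0 = 0" and step: "\<And>n. t (Suc n) = fps_bilin g l (t n)"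
  shows "hsum t = t 0 + fps_bilin g l (hsum t)"
proof (rule fps_ext)
  fix N
  have low: "fps_nth (t n) N = 0" if "N \<le> n" for n N
    using that
  proof (induction n arbitrary: N)
    case (Suc n)
    have "bilin_ext g (fps_nth l i) (fps_nth (t n) (N - i)) = 0" if "i \<le> N" for i
      using that Suc assms(1) by (cases "i = 0") auto
    then show ?case by (simp add: step fps_bilin_nth)
  qed (use assms(2) in simp)
  \<comment> \<open>Lengthening the truncated sums up to \<open>N\<close> gives them a common range,
    so that they can be exchanged with the sum over \<open>i\<close>.\<close>
  have ext: "(\<Sum>n<M. fps_nth (t n) M) = (\<Sum>n<N. fps_nth (t n) M)" if "M \<le> N" for M
    using that low by (intro sum.mono_neutral_left) auto
  \<comment> \<open>One more term, zero by \<open>low\<close>, makes room for splitting off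
    \<open>t 0\<close>.\<close>
  have "fps_nth (hsum t) N = (\<Sum>n<Suc N. fps_nth (t n) N)"
    by (simp add: hsum_nth low)
  also have "\<dots> = fps_nth (t 0) N +
      (\<Sum>n<N. \<Sum>i\<le>N. bilin_ext g (fps_nth l i) (fps_nth (t n) (N - i)))"
    by (simp only: sum.lessThan_Suc_shift step fps_bilin_nth)
  also have "(\<Sum>n<N. \<Sum>i\<le>N. bilin_ext g (fps_nth l i) (fps_nth (t n) (N - i))) =
      (\<Sum>i\<le>N. bilin_ext g (fps_nth l i) (fps_nth (hsum t) (N - i)))"
    by (subst sum.swap) (simp add: hsum_nth ext bilin_ext_sum_right)
  finally show "fps_nth (hsum t) N = fps_nth (t 0 + fps_bilin g l (hsum t)) N"
    by (simp add: fps_bilin_nth)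
qed


section \<open>The circle operation\<close>

text \<open>This is \<open>(1 + p) (1 + q) - 1\<close>, written so that it makes sense when the
  algebra has no unit.\<close>

definition circ ::
    "('x \<Rightarrow> 'x \<Rightarrow> ('x \<Rightarrow>\<^sub>0 'k::field)) \<Rightarrow> ('x \<Rightarrow>\<^sub>0 'k) fps \<Rightarrow> ('x \<Rightarrow>\<^sub>0 'k) fps \<Rightarrow> ('x \<Rightarrow>\<^sub>0 'k) fps" where
  "circ f p q = p + q + fps_bilin f p q"

lemma circ_0 [simp]: "circ f 0 q = q" "circ f p 0 = p"
  by (simp_all add: circ_def)

lemma circ_assoc: "assoc_mul f \<Longrightarrow> circ f (circ f p q) r = circ f p (circ f q r)"
  by (simp add: circ_def fps_bilin_add_left fps_bilin_add_right fps_bilin_assoc algebra_simps)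

lemma right_quasiinverse_exists:
  assumes "fps_nth p 0 = 0"
  obtains q where "fps_nth q 0 = 0" "circ f p q = 0"
proof
  \<comment> \<open>The geometric series: \<open>?t n\<close> is the power of \<open>- p\<close>
    with exponent \<open>n + 1\<close>, bracketed to the right. Its sum satisfies
    \<open>q = - p - p q\<close>, which is the required equation.\<close>
  let ?t = "rec_nat (- p) (\<lambda>_. fps_bilin f (- p))"
  have "hsum ?t = ?t 0 + fps_bilin f (- p) (hsum ?t)"
    using assms by (intro hsum_fixpoint) auto
  then show "circ f p (hsum ?t) = 0"
    by (simp add: circ_def fps_bilin_uminus_left algebra_simps)
qed simp

text \<open>The usual group argument: \<open>q\<close> has a right inverse \<open>w\<close> of its
  own, and associativity identifies \<open>w\<close> with \<open>p\<close>.\<close>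

lemma right_quasiinverse_imp_left:
  assumes "assoc_mul f" "fps_nth q 0 = 0" "circ f p q = 0"
  shows "circ f q p = 0"
proof -
  obtain w where w: "circ f q w = 0" using right_quasiinverse_exists[OF assms(2)] by blast
  have "w = circ f (circ f p q) w" using assms(3) by simp
  also have "\<dots> = p" using w by (simp add: circ_assoc[OF assms(1)])
  finally show ?thesis using w by simp
qed


section \<open>The Ito product of words\<close>

text \<open>Rank and places are packed into one triple, so that the double sum in
  \<open>ito_mul\<close> becomes a single sum that can be reindexed.\<close>

definition ito_index :: "nat \<Rightarrow> nat \<Rightarrow> (nat \<times> nat set \<times> nat set) set" where
  "ito_index p q = {(n, A, B). A \<union> B = {..<n} \<and> card A = p \<and> card B = q}"

lemma ito_indexD:
  assumes "(n, A, B) \<in> ito_index p q"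
  shows "A \<union> B = {..<n}" "card A = p" "card B = q" "A \<subseteq> {..<n}" "B \<subseteq> {..<n}"
    "finite A" "finite B" "n \<notin> A" "n \<notin> B" "n \<le> p + q"
proof -
  show AB: "A \<union> B = {..<n}" "card A = p" "card B = q"
    using assms by (auto simp: ito_index_def)
  from AB show sub: "A \<subseteq> {..<n}" "B \<subseteq> {..<n}" by auto
  then show "finite A" "finite B" "n \<notin> A" "n \<notin> B" by (auto intro: finite_subset)
  have "n = card (A \<union> B)" by (simp add: AB)
  then show "n \<le> p + q" using card_Un_le[of A B] AB by simp
qed

lemma ito_index_finite [simp]: "finite (ito_index p q)"
proof (rule finite_subset)
  show "ito_index p q \<subseteq> {..p + q} \<times> Pow {..<p + q} \<times> Pow {..<p + q}"
    using ito_indexD(4,5,10) by (fastforce dest: order_less_le_trans)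
qed simp

lemma ito_mul_index:
  "ito_mul u v = (\<Sum>(n, A, B)\<in>ito_index (length u) (length v). gen (ito_word A B n u v))"
proof -
  let ?P = "\<lambda>n::nat. {(A, B). A \<union> B = {..<n} \<and> card A = length u \<and> card B = length v}"
  have "finite (?P n)" for n
    by (rule finite_subset[of _ "Pow {..<n} \<times> Pow {..<n}"]) auto
  moreover have "ito_index (length u) (length v) = Sigma {..length u + length v} ?P"
  proof -
    have "n \<le> length u + length v"
      if "A \<union> B = {..<n}" "card A = length u" "card B = length v" for n A B
      using that by (intro ito_indexD(10)[of n A B]) (simp add: ito_index_def)
    then show ?thesis unfolding ito_index_def by blast
  qed
  ultimately show ?thesis
    unfolding ito_mul_def by (simp add: sum.Sigma case_prod_unfold)
qed

lemma place_letter_all: "i < length u \<Longrightarrow> place_letter {..<length u} u i = u ! i"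
proof -
  assume "i < length u"
  then have "{j \<in> {..<length u}. j < i} = {..<i}" by auto
  then show ?thesis by (simp add: place_letter_def)
qed

lemma ito_mul_Nil_left [simp]: "ito_mul [] v = gen v"
proof -
  have "ito_index 0 (length v) = {(length v, {}, {..<length v})}"
  proof (intro equalityI subsetI)
    fix t assume "t \<in> ito_index 0 (length v)"
    then obtain n A B where t: "t = (n, A, B)" "(n, A, B) \<in> ito_index 0 (length v)"
      by (cases t) auto
    from ito_indexD[OF t(2)] show "t \<in> {(length v, {}, {..<length v})}" by (auto simp: t(1))
  qed (auto simp: ito_index_def)
  moreover have "ito_word {} {..<length v} (length v) [] v = v"
    by (rule nth_equalityI) (auto simp: ito_word_def place_letter_all)
  ultimately show ?thesis by (simp add: ito_mul_index)
qed

lemma ito_mul_Nil_fun [simp]: "ito_mul [] = gen"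
  by (rule ext) simp

lemma ito_mul_Nil_right [simp]: "ito_mul u [] = gen u"
proof -
  have "ito_index (length u) 0 = {(length u, {..<length u}, {})}"
  proof (intro equalityI subsetI)
    fix t assume "t \<in> ito_index (length u) 0"
    then obtain n A B where t: "t = (n, A, B)" "(n, A, B) \<in> ito_index (length u) 0"
      by (cases t) auto
    from ito_indexD[OF t(2)] show "t \<in> {(length u, {..<length u}, {})}" by (auto simp: t(1))
  qed (auto simp: ito_index_def)
  moreover have "ito_word {..<length u} {} (length u) u [] = u"
    by (rule nth_equalityI) (auto simp: ito_word_def place_letter_all)
  ultimately show ?thesis by (simp add: ito_mul_index)
qed

text \<open>The new place \<open>n\<close> lies above all of \<open>A\<close>, so it does not change
  how many places precede \<open>i\<close>.\<close>

lemma place_letter_snoc: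
  assumes "card A = length u" "A \<subseteq> {..<n}" "finite A" "i \<in> A"
  shows "place_letter (insert n A) (u @ [x]) i = place_letter A u i"
proof -
  have "card {j \<in> A. j < i} < length u"
    unfolding assms(1)[symmetric] using assms(3,4) by (intro psubset_card_mono) auto
  moreover have "{j. (j = n \<or> j \<in> A) \<and> j < i} = {j \<in> A. j < i}" using assms(2,4) by auto
  ultimately show ?thesis by (simp add: place_letter_def nth_append)
qed

lemma place_letter_last:
  assumes "card A = length u" "A \<subseteq> {..<n}"
  shows "place_letter (insert n A) (u @ [x]) n = x"
proof -
  have "{j. (j = n \<or> j \<in> A) \<and> j < n} = A" using assms(2) by auto
  then show ?thesis using assms(1) by (simp add: place_letter_def)
qed

lemma ito_word_snoc_left:
  assumes "(n, A, B) \<in> ito_index (length u) q"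
  shows "ito_word (insert n A) B (Suc n) (u @ [x]) v = ito_word A B n u v @ [x]"
proof -
  note D = ito_indexD[OF assms]
  have "place_letter (insert n A) (u @ [x]) i = place_letter A u i" if "i \<in> A" for i
    using D(2,4,6) that by (intro place_letter_snoc)
  moreover have "place_letter (insert n A) (u @ [x]) n = x"
    using D(2,4) by (intro place_letter_last)
  ultimately show ?thesis using D(8,9) by (auto simp: ito_word_def)
qed

lemma ito_word_snoc_right:
  assumes "(n, A, B) \<in> ito_index p (length v)"
  shows "ito_word A (insert n B) (Suc n) u (v @ [y]) = ito_word A B n u v @ [y]"
proof -
  note D = ito_indexD[OF assms]
  have "place_letter (insert n B) (v @ [y]) i = place_letter B v i" if "i \<in> B" for i
    using D(3,5,7) that by (intro place_letter_snoc)
  moreover have "place_letter (insert n B) (v @ [y]) n = y"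
    using D(3,5) by (intro place_letter_last)
  moreover have "i \<in> B" if "i < n" "i \<notin> A" for i using that D(1) by blast
  ultimately show ?thesis using D(8,9) by (auto simp: ito_word_def)
qed

lemma ito_word_snoc_both:
  assumes "(n, A, B) \<in> ito_index (length u) (length v)"
  shows "ito_word (insert n A) (insert n B) (Suc n) (u @ [x]) (v @ [y]) = ito_word A B n u v @ [x * y]"
proof -
  note D = ito_indexD[OF assms]
  have "place_letter (insert n A) (u @ [x]) i = place_letter A u i" if "i \<in> A" for i
    using D(2,4,6) that by (intro place_letter_snoc)
  moreover have "place_letter (insert n B) (v @ [y]) i = place_letter B v i" if "i \<in> B" for i
    using D(3,5,7) that by (intro place_letter_snoc)
  moreover have "place_letter (insert n A) (u @ [x]) n = x" "place_letter (insert n B) (v @ [y]) n = y"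
    using D(2-5) by (intro place_letter_last; simp)+
  moreover have "i \<in> B" if "i < n" "i \<notin> A" for i using that D(1) by blast
  ultimately show ?thesis using D(8,9) by (auto simp: ito_word_def)
qed

text \<open>The last place belongs to \<open>A\<close> only, to \<open>B\<close> only, or to both;
  removing it leaves an index of rank one less.\<close>

lemma ito_index_Suc_Suc:
  "ito_index (Suc p) (Suc q) =
     (\<lambda>(n, A, B). (Suc n, insert n A, B)) ` ito_index p (Suc q) \<union>
     (\<lambda>(n, A, B). (Suc n, A, insert n B)) ` ito_index (Suc p) q \<union>
     (\<lambda>(n, A, B). (Suc n, insert n A, insert n B)) ` ito_index p q"
  (is "?I = ?f ` _ \<union> ?g ` _ \<union> ?h ` _")
proof (intro equalityI subsetI)
  fix t assume tI: "t \<in> ?I"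
  obtain n A B where t: "t = (n, A, B)" by (rule prod_cases3)
  with tI have I: "(n, A, B) \<in> ?I" by simp
  note D = ito_indexD[OF I]
  have "n \<noteq> 0" using D(1,2) by (cases "n = 0") simp_all
  then obtain m where m: "n = Suc m" using not0_implies_Suc by blast
  have "(A - {m}) \<union> (B - {m}) = (A \<union> B) - {m}" by blast
  also have "\<dots> = {..<m}" unfolding D(1) m by auto
  finally have un: "(A - {m}) \<union> (B - {m}) = {..<m}" .
  have mAB: "m \<in> A \<union> B" unfolding D(1) m by simp
  consider "m \<in> A" "m \<notin> B" | "m \<notin> A" "m \<in> B" | "m \<in> A" "m \<in> B"
    using mAB by blast
  then show "t \<in> ?f ` ito_index p (Suc q) \<union> ?g ` ito_index (Suc p) q \<union> ?h ` ito_index p q"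
  proof cases
    case 1
    then have "B - {m} = B" by simp_all
    then have "(m, A - {m}, B) \<in> ito_index p (Suc q)"
      using un D(2,3,6,7) 1 by (simp add: ito_index_def)
    moreover have "t = ?f (m, A - {m}, B)" using 1 by (simp add: t m insert_absorb)
    ultimately show ?thesis by blast
  next
    case 2
    then have "A - {m} = A" by simp_all
    then have "(m, A, B - {m}) \<in> ito_index (Suc p) q"
      using un D(2,3,6,7) 2 by (simp add: ito_index_def)
    moreover have "t = ?g (m, A, B - {m})" using 2 by (simp add: t m insert_absorb)
    ultimately show ?thesis by blast
  next
    case 3
    then have "(m, A - {m}, B - {m}) \<in> ito_index p q"
      using un D(2,3,6,7) by (simp add: ito_index_def)
    moreover have "t = ?h (m, A - {m}, B - {m})" using 3 by (simp add: t m insert_absorb)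
    ultimately show ?thesis by blast
  qed
next
  fix t assume "t \<in> ?f ` ito_index p (Suc q) \<union> ?g ` ito_index (Suc p) q \<union> ?h ` ito_index p q"
  then obtain n A B where
    "t = ?f (n, A, B) \<and> (n, A, B) \<in> ito_index p (Suc q) \<or>
     t = ?g (n, A, B) \<and> (n, A, B) \<in> ito_index (Suc p) q \<or>
     t = ?h (n, A, B) \<and> (n, A, B) \<in> ito_index p q" by (elim UnE imageE) auto
  then show "t \<in> ?I"
  proof (elim disjE conjE)
    assume t: "t = ?f (n, A, B)" and I: "(n, A, B) \<in> ito_index p (Suc q)"
    from ito_indexD[OF I] show ?thesis by (simp add: t ito_index_def lessThan_Suc)
  next
    assume t: "t = ?g (n, A, B)" and I: "(n, A, B) \<in> ito_index (Suc p) q"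
    from ito_indexD[OF I] show ?thesis by (simp add: t ito_index_def lessThan_Suc)
  next
    assume t: "t = ?h (n, A, B)" and I: "(n, A, B) \<in> ito_index p q"
    from ito_indexD[OF I] show ?thesis by (simp add: t ito_index_def lessThan_Suc)
  qed
qed

definition append_letter :: "'a \<Rightarrow> ('a list \<Rightarrow>\<^sub>0 'k::field) \<Rightarrow> ('a list \<Rightarrow>\<^sub>0 'k)" where
  "append_letter x = lin_ext (\<lambda>w. snoc w x)"

lemma append_letter_gen: "append_letter x (gen u) = gen (u @ [x])"
  by (simp add: append_letter_def snoc_def)

lemma append_letter_add: "append_letter x (p + q) = append_letter x p + append_letter x q"
  by (simp add: append_letter_def lin_ext_add)

text \<open>The quasi-shuffle recursion at the last letters. Its three terms correspond to the three
  ways in which the last place can be occupied, and in the third the letters are multiplied in the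
  algebra.\<close>

lemma ito_mul_snoc:
  "ito_mul (u @ [x]) (v @ [y]) = append_letter x (ito_mul u (v @ [y])) +
     append_letter y (ito_mul (u @ [x]) v) + append_letter (x * y) (ito_mul u v)"
proof -
  let ?p = "length u" and ?q = "length v"
  let ?f = "\<lambda>(n, A, B). (Suc n, insert n A, B)"
  let ?g = "\<lambda>(n, A, B). (Suc n, A, insert n B)"
  let ?h = "\<lambda>(n, A, B). (Suc n, insert n A, insert n B)"
  let ?w = "\<lambda>(n, A, B). gen (ito_word A B n (u @ [x]) (v @ [y]))"
  \<comment> \<open>The inverses remove the place \<open>n - 1\<close>, where \<open>n\<close> is
    the rank already raised by the map.\<close>
  have inj: "inj_on ?f (ito_index ?p (Suc ?q))" "inj_on ?g (ito_index (Suc ?p) ?q)"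
    "inj_on ?h (ito_index ?p ?q)"
    by (intro inj_on_inverseI[where g = "\<lambda>(n, A, B). (n - 1, A - {n - 1}, B)"]
        inj_on_inverseI[where g = "\<lambda>(n, A, B). (n - 1, A, B - {n - 1})"]
        inj_on_inverseI[where g = "\<lambda>(n, A, B). (n - 1, A - {n - 1}, B - {n - 1})"];
      auto dest: ito_indexD(8,9))+
  have disj: "?f ` ito_index ?p (Suc ?q) \<inter> ?g ` ito_index (Suc ?p) ?q = {}"
    "(?f ` ito_index ?p (Suc ?q) \<union> ?g ` ito_index (Suc ?p) ?q) \<inter> ?h ` ito_index ?p ?q = {}"
    by (auto dest: ito_indexD(8,9))
  have "ito_mul (u @ [x]) (v @ [y]) = sum ?w (ito_index (Suc ?p) (Suc ?q))"
    by (simp add: ito_mul_index)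
  also have "\<dots> = sum ?w (?f ` ito_index ?p (Suc ?q)) + sum ?w (?g ` ito_index (Suc ?p) ?q) +
      sum ?w (?h ` ito_index ?p ?q)"
    unfolding ito_index_Suc_Suc using disj by (simp add: sum.union_disjoint)
  also have "sum ?w (?f ` ito_index ?p (Suc ?q)) = append_letter x (ito_mul u (v @ [y]))"
    unfolding sum.reindex[OF inj(1)] ito_mul_index append_letter_def lin_ext_sum
    by (rule sum.cong) (auto simp: ito_word_snoc_left snoc_def)
  also have "sum ?w (?g ` ito_index (Suc ?p) ?q) = append_letter y (ito_mul (u @ [x]) v)"
    unfolding sum.reindex[OF inj(2)] ito_mul_index append_letter_def lin_ext_sum
    by (rule sum.cong) (auto simp: ito_word_snoc_right snoc_def)
  also have "sum ?w (?h ` ito_index ?p ?q) = append_letter (x * y) (ito_mul u v)"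
    unfolding sum.reindex[OF inj(3)] ito_mul_index append_letter_def lin_ext_sum
    by (rule sum.cong) (auto simp: ito_word_snoc_both snoc_def)
  finally show ?thesis .
qed

section \<open>Associativity of the Ito product\<close>

abbreviation ito_times :: "('a::ring list \<Rightarrow>\<^sub>0 'k::field) \<Rightarrow> ('a list \<Rightarrow>\<^sub>0 'k) \<Rightarrow> ('a list \<Rightarrow>\<^sub>0 'k)" where
  "ito_times \<equiv> bilin_ext ito_mul"

lemma ito_times_append_letter:
  "ito_times (append_letter x p) (append_letter y q) =
     append_letter x (ito_times p (append_letter y q)) +
     append_letter y (ito_times (append_letter x p) q) + append_letter (x * y) (ito_times p q)"
  by (simp add: bilin_ext_def append_letter_def lin_ext_lin_ext snoc_def ito_mul_snoc
      lin_ext_fun_add lin_ext_add)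

lemma ito_times_Nil [simp]: "ito_times (gen []) q = q" "ito_times p (gen []) = p"
  by (simp_all add: bilin_ext_gen_right)

text \<open>Induction on the last letters of all three words. Both bracketings expand into seven
  terms, one for each nonempty set of words that contribute to the last letter; associativity of the
  algebra matches these letters.\<close>

lemma ito_times_assoc_gen:
  "ito_times (ito_times (gen u) (gen v)) (gen w) =
   ito_times (gen u) (ito_times (gen v) (gen w) :: 'a::ring list \<Rightarrow>\<^sub>0 'k::field)"
proof (induction u arbitrary: v w rule: rev_induct)
  case Nil
  show ?case by (simp del: bilin_ext_gen)
next
  case IHu: (snoc x u)
  show ?case
  proof (induction v arbitrary: w rule: rev_induct)
    case Nil
    show ?case by (simp del: bilin_ext_gen)
  next
    case IHv: (snoc y v)
    show ?case
    proof (induction w rule: rev_induct)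
      case Nil
      show ?case by (simp del: bilin_ext_gen)
    next
      case IHw: (snoc z w)
      let ?u = "gen u :: 'a list \<Rightarrow>\<^sub>0 'k" and ?v = "gen v :: 'a list \<Rightarrow>\<^sub>0 'k"
        and ?w = "gen w :: 'a list \<Rightarrow>\<^sub>0 'k"
      let ?U = "append_letter x ?u" and ?V = "append_letter y ?v" and ?W = "append_letter z ?w"
      note expand = ito_times_append_letter bilin_ext_add_left bilin_ext_add_right append_letter_add
      have "ito_times (ito_times ?U ?V) ?W =
          append_letter x (ito_times (ito_times ?u ?V) ?W) +
          append_letter y (ito_times (ito_times ?U ?v) ?W) +
          append_letter (x * y) (ito_times (ito_times ?u ?v) ?W) +
          append_letter z (ito_times (ito_times ?U ?V) ?w) +
          append_letter (x * z) (ito_times (ito_times ?u ?V) ?w) +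
          append_letter (y * z) (ito_times (ito_times ?U ?v) ?w) +
          append_letter (x * y * z) (ito_times (ito_times ?u ?v) ?w)"
        by (simp add: expand ac_simps del: bilin_ext_gen)
      \<comment> \<open>The four terms with the shortened \<open>?u\<close> use \<open>IHu\<close>,
        the two with \<open>?U\<close> and the shortened \<open>?v\<close> use \<open>IHv\<close>,
        and the one where only \<open>?w\<close> is shortened uses \<open>IHw\<close>.\<close>
      also have "\<dots> = append_letter x (ito_times ?u (ito_times ?V ?W)) +
          append_letter y (ito_times ?U (ito_times ?v ?W)) +
          append_letter (x * y) (ito_times ?u (ito_times ?v ?W)) +
          append_letter z (ito_times ?U (ito_times ?V ?w)) +
          append_letter (x * z) (ito_times ?u (ito_times ?V ?w)) +
          append_letter (y * z) (ito_times ?U (ito_times ?v ?w)) +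
          append_letter (x * y * z) (ito_times ?u (ito_times ?v ?w))"
        using IHu IHv IHw by (simp only: append_letter_gen)
      also have "\<dots> = ito_times ?U (ito_times ?V ?W)"
        by (simp add: expand ac_simps del: bilin_ext_gen)
      finally show ?case by (simp only: append_letter_gen)
    qed
  qed
qed

lemma assoc_ito_mul: "assoc_mul (ito_mul :: 'a::ring list \<Rightarrow> 'a list \<Rightarrow> ('a list \<Rightarrow>\<^sub>0 'k::field))"
proof -
  have "lin_ext (\<lambda>w. ito_mul w z) (ito_mul x y) = (lin_ext (ito_mul x) (ito_mul y z) :: 'a list \<Rightarrow>\<^sub>0 'k)"
    for x y z :: "'a list"
    using ito_times_assoc_gen[of x y z, where ?'k = 'k] by (simp only: bilin_ext_gen lin_ext_gen bilin_ext_gen_right)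
  then show ?thesis unfolding assoc_maps_def by blast
qed

lemma assoc_L_mul: "assoc_mul (L_mul :: 'a::ring \<Rightarrow> 'a \<Rightarrow> ('a \<Rightarrow>\<^sub>0 'k::field))"
  by (simp add: assoc_maps_def L_mul_def mult.assoc)

lemma tensor_mul_add_right:
  "tensor_mul f (\<lambda>u v. g u v + h u v) = (\<lambda>x y. tensor_mul f g x y + tensor_mul f h x y)"
  by (auto simp: fun_eq_iff tensor_mul_def tensor_add_right)

text \<open>
  The terms of the Ito product are sorted by the origin of the last letter: it comes from the first
  word only, from the second word only, or from both.  The product of two empty words is counted
  with the first kind.
\<close>

definition ito_left :: "'a::ring list \<Rightarrow> 'a list \<Rightarrow> ('a list \<Rightarrow>\<^sub>0 'k::field)" where
  "ito_left u v = (if u = [] then (if v = [] then gen [] else 0)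
     else append_letter (last u) (ito_mul (butlast u) v))"

definition ito_right :: "'a::ring list \<Rightarrow> 'a list \<Rightarrow> ('a list \<Rightarrow>\<^sub>0 'k::field)" where
  "ito_right u v = (if v = [] then 0 else append_letter (last v) (ito_mul u (butlast v)))"

definition ito_both :: "'a::ring list \<Rightarrow> 'a list \<Rightarrow> ('a list \<Rightarrow>\<^sub>0 'k::field)" where
  "ito_both u v = (if u = [] \<or> v = [] then 0
     else append_letter (last u * last v) (ito_mul (butlast u) (butlast v)))"

lemma ito_mul_split: "ito_mul u v = ito_left u v + ito_right u v + ito_both u v"
proof (cases u rule: rev_cases)
  case Nil
  then show ?thesis
    by (cases v rule: rev_cases) (simp_all add: ito_left_def ito_right_def ito_both_def append_letter_gen)
next
  case (snoc u' x)
  then show ?thesis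
    by (cases v rule: rev_cases)
      (simp_all add: ito_left_def ito_right_def ito_both_def append_letter_gen ito_mul_snoc)
qed


section \<open>Product integrals\<close>

definition letter_word :: "'x \<times> 'a \<Rightarrow> ('x \<times> 'a list \<Rightarrow>\<^sub>0 'k::field)" where
  "letter_word = (\<lambda>(a, x). gen (a, [x]))"

lemma left_fwd_hat_fixpoint:
  assumes "fps_nth l 0 = 0"
  shows "left_fwd_hat f l = fps_lin letter_word l + fps_bilin (tensor_mul f snoc) (left_fwd_hat f l) l"
proof -
  \<comment> \<open>The forward terms grow on the right, while \<open>hsum_fixpoint\<close>
    multiplies by \<open>l\<close> on the left, hence the flipped product.\<close>
  have "hsum (left_fwd_term f l) =
      left_fwd_term f l 0 + fps_bilin (\<lambda>y x. tensor_mul f snoc x y) l (hsum (left_fwd_term f l))"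
    by (rule hsum_fixpoint)
      (use assms in \<open>simp_all add: fps_lin_def fps_bilin_flip[of "tensor_mul f snoc"]\<close>)
  then show ?thesis
    by (simp add: left_fwd_hat_def letter_word_def fps_bilin_flip[of "tensor_mul f snoc"])
qed

lemma left_bwd_hat_fixpoint:
  assumes "fps_nth l 0 = 0"
  shows "left_bwd_hat f l =
    fps_lin letter_word l + fps_bilin (tensor_mul f (\<lambda>x w. snoc w x)) l (left_bwd_hat f l)"
proof -
  have "hsum (left_bwd_term f l) = left_bwd_term f l 0 +
      fps_bilin (tensor_mul f (\<lambda>x w. snoc w x)) l (hsum (left_bwd_term f l))"
    by (rule hsum_fixpoint) (use assms in \<open>simp_all add: fps_lin_def\<close>)
  then show ?thesis by (simp add: left_bwd_hat_def letter_word_def)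
qed

text \<open>
  In \<open>p \<cdot> m \<cdot> q\<close>, with the last letter supplied by \<open>m\<close>, the factors \<open>m\<close> and \<open>q\<close> are first paired:
  the pair \<open>(v, x)\<close> stands for the word \<open>v\<close> followed by the letter \<open>x\<close>.
\<close>

definition pair_word :: "'a \<Rightarrow> 'a list \<Rightarrow> ('a list \<times> 'a \<Rightarrow>\<^sub>0 'k::field)" where
  "pair_word x v = gen (v, x)"

text \<open>The case where a letter of the left factor meets the last letter of \<open>v\<close> in
  one place. An empty \<open>v\<close> has no letter to meet and contributes zero.\<close>

definition pair_mul :: "'a::ring \<Rightarrow> 'a list \<Rightarrow> ('a list \<times> 'a \<Rightarrow>\<^sub>0 'k::field)" where
  "pair_mul x v = (if v = [] then 0 else gen (butlast v, x * last v))"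

definition word_pair :: "'a::ring list \<Rightarrow> 'a list \<times> 'a \<Rightarrow> ('a list \<Rightarrow>\<^sub>0 'k::field)" where
  "word_pair u = (\<lambda>(v, x). append_letter x (ito_mul u v))"

definition join_pair :: "'x \<times> 'a list \<times> 'a \<Rightarrow> ('x \<times> 'a list \<Rightarrow>\<^sub>0 'k::field)" where
  "join_pair = (\<lambda>(a, v, x). gen (a, v @ [x]))"

text \<open>Pairing with \<open>q = 1\<close>. It gets its own map because the system algebra may
  lack a unit, so that \<open>1\<close> need not be available as a series.\<close>

definition letter_pair :: "'x \<times> 'a \<Rightarrow> ('x \<times> 'a list \<times> 'a \<Rightarrow>\<^sub>0 'k::field)" where
  "letter_pair = (\<lambda>(a, x). gen (a, [], x))"

definition insert_last ::
    "('x \<Rightarrow> 'x \<Rightarrow> ('x \<Rightarrow>\<^sub>0 'k::field)) \<Rightarrow> ('x \<times> 'a::ring list \<Rightarrow>\<^sub>0 'k) fps \<Rightarrow> ('x \<times> 'a \<Rightarrow>\<^sub>0 'k) fps \<Rightarrow>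
     ('x \<times> 'a list \<Rightarrow>\<^sub>0 'k) fps \<Rightarrow> ('x \<times> 'a list \<Rightarrow>\<^sub>0 'k) fps" where
  "insert_last f p m q = fps_bilin (tensor_mul f word_pair) p (fps_bilin (tensor_mul f pair_word) m q)"

lemma insert_last_add:
  "insert_last f p (m + m') q = insert_last f p m q + insert_last f p m' q"
  by (simp add: insert_last_def fps_bilin_add_left fps_bilin_add_right)

lemma insert_last_0 [simp]: "insert_last f p 0 q = 0"
  by (simp add: insert_last_def)

section \<open>Rules for the three kinds of Ito terms\<close>

context
  fixes f :: "'x \<Rightarrow> 'x \<Rightarrow> ('x \<Rightarrow>\<^sub>0 'k::field)"
begin

abbreviation app_right :: "('x \<times> 'a list \<Rightarrow>\<^sub>0 'k) fps \<Rightarrow> ('x \<times> 'a \<Rightarrow>\<^sub>0 'k) fps \<Rightarrow> ('x \<times> 'a list \<Rightarrow>\<^sub>0 'k) fps" where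
  "app_right \<equiv> fps_bilin (tensor_mul f snoc)"

abbreviation app_left :: "('x \<times> 'a \<Rightarrow>\<^sub>0 'k) fps \<Rightarrow> ('x \<times> 'a list \<Rightarrow>\<^sub>0 'k) fps \<Rightarrow> ('x \<times> 'a list \<Rightarrow>\<^sub>0 'k) fps" where
  "app_left \<equiv> fps_bilin (tensor_mul f (\<lambda>x w. snoc w x))"

lemma join_pair_pair_word:
  "fps_lin join_pair (fps_bilin (tensor_mul f pair_word) m q) = app_left m q"
  unfolding fps_lin_fps_bilin
  by (rule fps_bilin_cong_pair)
    (simp add: pair_word_def snoc_def join_pair_def tensor_gen_right lin_ext_lin_ext)

lemma join_pair_letter_pair: "fps_lin join_pair (fps_lin letter_pair m) = fps_lin letter_word m"
  unfolding fps_lin_fps_lin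
  by (rule fps_lin_cong_pair) (simp add: letter_pair_def letter_word_def join_pair_def)

lemma pair_mul_letter_word:
  "fps_bilin (tensor_mul f pair_mul) l (fps_lin letter_word m) =
   fps_lin letter_pair (fps_bilin (tensor_mul f L_mul) l m)"
  unfolding fps_lin_fps_bilin fps_bilin_fps_lin_right
  by (rule fps_bilin_cong_pair)
    (simp add: pair_mul_def letter_word_def letter_pair_def L_mul_def tensor_gen_right lin_ext_lin_ext)

lemma word_pair_letter_pair:
  "fps_bilin (tensor_mul f word_pair) p (fps_lin letter_pair m) = app_right p m"
  unfolding fps_bilin_fps_lin_right
  by (rule fps_bilin_cong_pair)
    (simp add: word_pair_def letter_pair_def snoc_def append_letter_gen)

lemma ito_left_letter_word:
  "fps_bilin (tensor_mul f ito_left) (fps_lin letter_word l) q = app_left l q"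
  unfolding fps_bilin_fps_lin_left
  by (rule fps_bilin_cong_pair)
    (simp add: letter_word_def ito_left_def snoc_def append_letter_gen)

lemma ito_right_letter_word:
  "fps_bilin (tensor_mul f ito_right) p (fps_lin letter_word m) = app_right p m"
  unfolding fps_bilin_fps_lin_right
  by (rule fps_bilin_cong_pair)
    (simp add: letter_word_def ito_right_def snoc_def append_letter_gen)

text \<open>The last letter of the second factor is the letter of \<open>m\<close>. The rest of its
  word comes from \<open>q\<close> and is multiplied with the word from \<open>p\<close> before that
  letter is appended.\<close>

lemma ito_right_app_left:
  "fps_bilin (tensor_mul f ito_right) p (app_left m q) = insert_last f p m q"
  unfolding insert_last_def join_pair_pair_word[symmetric] fps_bilin_fps_lin_right
  by (rule fps_bilin_cong_pair)
    (simp add: join_pair_def ito_right_def word_pair_def case_prod_unfold)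

lemma ito_both_letter_word:
  "fps_bilin (tensor_mul f ito_both) (fps_lin letter_word l) q =
   fps_lin join_pair (fps_bilin (tensor_mul f pair_mul) l q)"
  unfolding fps_lin_fps_bilin fps_bilin_fps_lin_left
  by (rule fps_bilin_cong_pair)
    (simp add: letter_word_def ito_both_def pair_mul_def join_pair_def append_letter_gen
        tensor_gen_right lin_ext_lin_ext)

context
  assumes assoc: "assoc_mul f"
begin

text \<open>The last letter of the first factor comes from \<open>l\<close>, so the mixed
  associativity law moves the bracket from \<open>(p l) q\<close> to \<open>p (l q)\<close> with
  that letter kept aside.\<close>

lemma ito_left_app_right:
  "fps_bilin (tensor_mul f ito_left) (app_right p l) q = insert_last f p l q"
  unfolding insert_last_def
  by (intro fps_bilin_assoc assoc_maps_tensor_mul assoc)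
    (simp add: assoc_maps_def ito_left_def snoc_def word_pair_def pair_word_def)

lemma ito_both_app_right:
  "fps_bilin (tensor_mul f ito_both) (app_right p l) q =
   fps_bilin (tensor_mul f word_pair) p (fps_bilin (tensor_mul f pair_mul) l q)"
  by (intro fps_bilin_assoc assoc_maps_tensor_mul assoc)
    (simp add: assoc_maps_def ito_both_def snoc_def word_pair_def pair_mul_def)

text \<open>The letter of \<open>l\<close> meets the letter of \<open>m\<close>, so both factors
  merge into the single factor \<open>l m\<close>.\<close>

lemma pair_mul_app_left:
  "fps_bilin (tensor_mul f pair_mul) l (app_left m q) =
   fps_bilin (tensor_mul f pair_word) (fps_bilin (tensor_mul f L_mul) l m) q"
  by (rule fps_bilin_assoc[symmetric], intro assoc_maps_tensor_mul assoc)
    (simp add: assoc_maps_def pair_word_def L_mul_def pair_mul_def snoc_def)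

text \<open>
  \<open>P = (1 + P) l\<close> and \<open>Q = l' (1 + Q)\<close> with the new letter last, so that the three kinds of terms in
  \<open>(1 + P) (1 + Q)\<close> contribute the summands of the middle factor \<open>l + l' + l l'\<close> in turn.
\<close>

lemma left_hat_quasiinverse:
  fixes l l' :: "('x \<times> 'a::ring \<Rightarrow>\<^sub>0 'k) fps"
  assumes "fps_nth l 0 = 0" "fps_nth l' 0 = 0"
    and "circ (tensor_mul f L_mul) l l' = 0"
  shows "circ (tensor_mul f ito_mul) (left_fwd_hat f l) (left_bwd_hat f l') = 0"
proof -
  define P where "P = left_fwd_hat f l"
  define Q where "Q = left_bwd_hat f l'"
  define c where "c = fps_bilin (tensor_mul f L_mul) l l'"
  have P: "P = fps_lin letter_word l + app_right P l"
    unfolding P_def by (rule left_fwd_hat_fixpoint[OF assms(1)])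
  have Q: "Q = fps_lin letter_word l' + app_left l' Q"
    unfolding Q_def by (rule left_bwd_hat_fixpoint[OF assms(2)])
  have left: "fps_bilin (tensor_mul f ito_left) P Q = app_left l Q + insert_last f P l Q"
    by (subst P) (simp add: fps_bilin_add_left ito_left_letter_word ito_left_app_right)
  have right: "fps_bilin (tensor_mul f ito_right) P Q = app_right P l' + insert_last f P l' Q"
    by (subst Q) (simp add: fps_bilin_add_right ito_right_letter_word ito_right_app_left)
  \<comment> \<open>Since \<open>Q = l' (1 + Q)\<close>, the letter of \<open>l\<close> always meets
    one of \<open>l'\<close>; the result is \<open>c (1 + Q)\<close> in paired form.\<close>
  have pair: "fps_bilin (tensor_mul f pair_mul) l Q =
      fps_lin letter_pair c + fps_bilin (tensor_mul f pair_word) c Q"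
    unfolding c_def
    by (subst Q) (simp add: fps_bilin_add_right pair_mul_letter_word pair_mul_app_left)
  have both: "fps_bilin (tensor_mul f ito_both) P Q =
      fps_lin letter_word c + app_left c Q + (app_right P c + insert_last f P c Q)"
    by (subst P) (simp add: fps_bilin_add_left ito_both_letter_word ito_both_app_right pair
        fps_lin_add join_pair_letter_pair join_pair_pair_word fps_bilin_add_right
        word_pair_letter_pair insert_last_def)
  have "fps_bilin (tensor_mul f ito_mul) P Q = fps_bilin (tensor_mul f ito_left) P Q +
      fps_bilin (tensor_mul f ito_right) P Q + fps_bilin (tensor_mul f ito_both) P Q"
    by (simp add: ito_mul_split[abs_def] tensor_mul_add_right fps_bilin_fun_add)
  \<comment> \<open>The summands \<open>P\<close> and \<open>Q\<close> of \<open>circ\<close>,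
    unfolded once, supply the terms without a factor from the other side. Now each of
    \<open>l\<close>, \<open>l'\<close> and \<open>c\<close> occurs alone, after \<open>P\<close>,
    before \<open>Q\<close>, and between both.\<close>
  then have "circ (tensor_mul f ito_mul) P Q =
      (fps_lin letter_word l + app_right P l) + (fps_lin letter_word l' + app_left l' Q) +
      (app_left l Q + insert_last f P l Q + (app_right P l' + insert_last f P l' Q) +
       (fps_lin letter_word c + app_left c Q + (app_right P c + insert_last f P c Q)))"
    using P Q by (simp add: circ_def left right both)
  also have "\<dots> = fps_lin letter_word (l + l' + c) + app_right P (l + l' + c) +
      app_left (l + l' + c) Q + insert_last f P (l + l' + c) Q"
    by (simp add: fps_lin_add fps_bilin_add_left fps_bilin_add_right insert_last_add)
  also have "l + l' + c = 0"
    using assms(3) by (simp add: circ_def c_def)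
  finally show ?thesis by (simp add: P_def Q_def)
qed

end

end


section \<open>Exchanging the tensor factors\<close>

definition fps_swap :: "('x \<times> 'y \<Rightarrow>\<^sub>0 'k::field) fps \<Rightarrow> ('y \<times> 'x \<Rightarrow>\<^sub>0 'k) fps" where
  "fps_swap = fps_lin (\<lambda>(x, y). gen (y, x))"

lemma fps_swap_swap [simp]: "fps_swap (fps_swap p) = p"
proof -
  have "fps_swap (fps_swap p) = fps_lin gen p"
    unfolding fps_swap_def fps_lin_fps_lin by (rule fps_lin_cong_pair) simp
  then show ?thesis by simp
qed

lemma fps_swap_0 [simp]: "fps_swap 0 = 0"
  by (simp add: fps_swap_def)

lemma fps_swap_nth_0: "fps_nth p 0 = 0 \<Longrightarrow> fps_nth (fps_swap p) 0 = 0"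
  by (simp add: fps_swap_def fps_lin_def)

lemma lin_ext_swap_tensor: "lin_ext (\<lambda>(x, y). gen (y, x)) (tensor p q) = tensor q p"
  unfolding lin_ext_tensor by (simp add: tensor_def bilin_ext_def lin_ext_swap[of _ q p])

lemma fps_swap_bilin:
  "fps_swap (fps_bilin (tensor_mul f g) p q) = fps_bilin (tensor_mul g f) (fps_swap p) (fps_swap q)"
  unfolding fps_swap_def fps_lin_fps_bilin fps_bilin_fps_lin_left fps_bilin_fps_lin_right
  by (rule fps_bilin_cong_pair) (simp add: lin_ext_swap_tensor)

lemma fps_swap_circ:
  "fps_swap (circ (tensor_mul f g) p q) = circ (tensor_mul g f) (fps_swap p) (fps_swap q)"
  by (simp add: circ_def fps_swap_bilin[symmetric]) (simp add: fps_swap_def fps_lin_add)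

lemma fps_swap_letter_word:
  "fps_lin (\<lambda>(x, a). gen ([x], a)) m = fps_swap (fps_lin (\<lambda>(a, x). gen (a, [x])) (fps_swap m))"
  by (simp add: fps_swap_def fps_lin_fps_lin case_prod_unfold)

text \<open>Exchanging the tensor factors turns the right integrals into left ones, so that
  \<open>left_hat_quasiinverse\<close> need not be proved twice.\<close>

lemma right_hat_swap:
  "right_fwd_hat f m = fps_swap (left_fwd_hat f (fps_swap m))"
  "right_bwd_hat f m = fps_swap (left_bwd_hat f (fps_swap m))"
proof -
  have "right_fwd_term f m n = fps_swap (left_fwd_term f (fps_swap m) n)"
    and "right_bwd_term f m n = fps_swap (left_bwd_term f (fps_swap m) n)" for n
    by (induction n) (simp_all add: fps_swap_letter_word fps_swap_bilin)
  then have "right_fwd_term f m = (\<lambda>n. fps_swap (left_fwd_term f (fps_swap m) n))"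
    and "right_bwd_term f m = (\<lambda>n. fps_swap (left_bwd_term f (fps_swap m) n))" by auto
  then show "right_fwd_hat f m = fps_swap (left_fwd_hat f (fps_swap m))"
    and "right_bwd_hat f m = fps_swap (left_bwd_hat f (fps_swap m))"
    by (simp_all add: right_fwd_hat_def right_bwd_hat_def left_fwd_hat_def left_bwd_hat_def
        fps_swap_def hsum_fps_lin)
qed

lemma right_hat_quasiinverse:
  assumes "assoc_mul f" "fps_nth m 0 = 0" "fps_nth m' 0 = 0"
    and "circ (tensor_mul L_mul f) m m' = 0"
  shows "circ (tensor_mul ito_mul f) (right_fwd_hat f m) (right_bwd_hat f m') = 0"
proof -
  have "circ (tensor_mul f L_mul) (fps_swap m) (fps_swap m') = 0"
    using assms(4) by (simp add: fps_swap_circ[symmetric])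
  then have "circ (tensor_mul f ito_mul) (left_fwd_hat f (fps_swap m)) (left_bwd_hat f (fps_swap m')) = 0"
    using assms(1-3) by (intro left_hat_quasiinverse fps_swap_nth_0)
  then show ?thesis by (simp add: right_hat_swap fps_swap_circ[symmetric])
qed


section \<open>The double product integrals\<close>

lemma TT_times_one [simp]: "TT_times TT_one p = p" "TT_times p TT_one = p"
proof -
  have coeff: "fps_nth (TT_times TT_one p) N = fps_nth p N" for N
  proof -
    have "fps_nth (TT_times TT_one p) N =
        (\<Sum>i\<le>N. if i = 0 then fps_nth p N else 0)"
      unfolding TT_times_def fps_bilin_nth
      by (rule sum.cong) (auto simp: TT_one_def tensor_mul_def case_prod_unfold)
    then show ?thesis by simp
  qed
  then show "TT_times TT_one p = p" by (rule fps_ext)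
  have "fps_nth (TT_times p TT_one) N = fps_nth p N" for N
  proof -
    have "fps_nth (TT_times p TT_one) N =
        (\<Sum>i\<le>N. if i = N then fps_nth p N else 0)"
      unfolding TT_times_def fps_bilin_nth
      by (rule sum.cong)
        (auto simp: TT_one_def tensor_mul_def case_prod_unfold bilin_ext_gen_right)
    then show ?thesis by simp
  qed
  then show "TT_times p TT_one = p" by (rule fps_ext)
qed

text \<open>This turns quasiinverses of the decapitated integrals into inverses of the full
  ones.\<close>

lemma TT_times_one_plus:
  "TT_times (TT_one + p) (TT_one + q) = TT_one + circ (tensor_mul ito_mul ito_mul) p q"
proof -
  have "TT_times (TT_one + p) (TT_one + q) =
      TT_times TT_one TT_one + TT_times TT_one q + (TT_times p TT_one + TT_times p q)"
    by (simp add: TT_times_def fps_bilin_add_left fps_bilin_add_right del: TT_times_one)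
  then show ?thesis by (simp add: circ_def TT_times_def[symmetric] ac_simps)
qed

lemma double_inverse:
  assumes r: "fps_nth r 0 = 0" and r': "fps_nth r' 0 = 0"
    and "circ (tensor_mul L_mul L_mul) r r' = 0"
  shows "TT_times (double_fwd_bwd r) (double_bwd_fwd r') = TT_one"
    and "TT_times (double_bwd_fwd r') (double_fwd_bwd r) = TT_one"
proof -
  let ?M = "right_bwd_hat L_mul r" and ?N = "right_fwd_hat L_mul r'"
  have M: "fps_nth ?M 0 = 0" and N: "fps_nth ?N 0 = 0"
    by (simp_all add: right_bwd_hat_def right_fwd_hat_def)
  \<comment> \<open>The quasiinverse lemma has the forward integral on the left. The inner forward
    integral is that of \<open>r'\<close>, so \<open>r\<close> and \<open>r'\<close> change sides
    first.\<close>
  have "circ (tensor_mul L_mul L_mul) r' r = 0"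
    by (rule right_quasiinverse_imp_left[OF assoc_maps_tensor_mul[OF assoc_L_mul assoc_L_mul] r' assms(3)])
  then have "circ (tensor_mul ito_mul L_mul) ?N ?M = 0"
    by (rule right_hat_quasiinverse[OF assoc_L_mul r' r])
  \<comment> \<open>The outer forward integral is taken over \<open>?M\<close>, so \<open>?M\<close>
    has to return to the left.\<close>
  then have "circ (tensor_mul ito_mul L_mul) ?M ?N = 0"
    by (rule right_quasiinverse_imp_left[OF assoc_maps_tensor_mul[OF assoc_ito_mul assoc_L_mul] M])
  then have *: "circ (tensor_mul ito_mul ito_mul) (left_fwd_hat ito_mul ?M) (left_bwd_hat ito_mul ?N) = 0"
    by (rule left_hat_quasiinverse[OF assoc_ito_mul M N])
  have "circ (tensor_mul ito_mul ito_mul) (left_bwd_hat ito_mul ?N) (left_fwd_hat ito_mul ?M) = 0"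
    by (rule right_quasiinverse_imp_left[OF assoc_maps_tensor_mul[OF assoc_ito_mul assoc_ito_mul] _ *])
      (simp add: left_bwd_hat_def)
  with * show "TT_times (double_fwd_bwd r) (double_bwd_fwd r') = TT_one"
    and "TT_times (double_bwd_fwd r') (double_fwd_bwd r) = TT_one"
    by (simp_all add: double_fwd_bwd_def double_bwd_fwd_def TT_times_one_plus)
qed

section \<open>Passage to the quotient spaces\<close>

lemma fps_equiv_refl: "free.subspace R \<Longrightarrow> fps_equiv R p p"
  by (simp add: fps_equiv_def free.subspace_0)

lemma fps_equiv_add:
  assumes "free.subspace R" "fps_equiv R p p'" "fps_equiv R q q'"
  shows "fps_equiv R (p + q) (p' + q')"
proof -
  have "(fps_nth p N - fps_nth p' N) + (fps_nth q N - fps_nth q' N) \<in> R" for N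
    using assms by (intro free.subspace_add) (auto simp: fps_equiv_def)
  then show ?thesis by (simp add: fps_equiv_def algebra_simps)
qed

context fin_dim_algebra
begin

lemma LL_circ_well_defined:
  assumes "LL_equiv scale p p'" "LL_equiv scale q q'"
  shows "LL_equiv scale (circ (tensor_mul L_mul L_mul) p q) (circ (tensor_mul L_mul L_mul) p' q')"
  unfolding circ_def LL_times_def[symmetric]
  using assms by (intro fps_equiv_add LL_times_well_defined subspace_rels)

text \<open>Bracketing \<open>s\<close>, \<open>r\<close>, \<open>r'\<close> in two ways gives
  \<open>s\<close> exactly and \<open>r'\<close> modulo relations, because \<open>s\<close> inverts
  \<open>r\<close> only in the quotient.\<close>

lemma is_quasiinverse_unique:
  assumes "circ (tensor_mul L_mul L_mul) r r' = 0" "is_quasiinverse scale r s"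
  shows "LL_equiv scale s r'"
proof -
  let ?circ = "circ (tensor_mul L_mul L_mul)"
  have "LL_equiv scale (?circ s r) 0"
    using assms(2) by (simp add: is_quasiinverse_def circ_def LL_times_def)
  then have "LL_equiv scale (?circ (?circ s r) r') (?circ 0 r')"
    by (intro LL_circ_well_defined fps_equiv_refl subspace_rels)
  moreover have "?circ (?circ s r) r' = s"
    using assms(1) by (simp add: circ_assoc assoc_maps_tensor_mul assoc_L_mul)
  ultimately show ?thesis by simp
qed

end

theorem theorem2:
  fixes scale :: "'k::field \<Rightarrow> 'a::ring \<Rightarrow> 'a"
    and Basis :: "'a set"
    and r :: "('a \<times> 'a \<Rightarrow>\<^sub>0 'k) fps"
  assumes "fin_dim_algebra scale Basis"
    and "fps_nth r 0 = 0"
  shows "(\<exists>r'. is_quasiinverse scale r r' \<and>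
           (\<forall>s. is_quasiinverse scale r s \<longrightarrow> LL_equiv scale s r')) \<and>
         (\<forall>r'. is_quasiinverse scale r r' \<longrightarrow>
           is_TT_inverse scale (double_fwd_bwd r) (double_bwd_fwd r'))"
proof -
  interpret fin_dim_algebra scale Basis by (rule assms(1))
  \<comment> \<open>The geometric series inverts \<open>r\<close> already at the level of
    representatives, which is what \<open>double_inverse\<close> requires.\<close>
  obtain t where t: "fps_nth t 0 = 0" "circ (tensor_mul L_mul L_mul) r t = 0"
    using right_quasiinverse_exists[OF assms(2)] by blast
  have t': "circ (tensor_mul L_mul L_mul) t r = 0"
    by (rule right_quasiinverse_imp_left[OF assoc_maps_tensor_mul[OF assoc_L_mul assoc_L_mul] t])
  have "is_quasiinverse scale r t"
    using t t' by (simp add: is_quasiinverse_def circ_def LL_times_def fps_equiv_refl)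
  moreover have "is_TT_inverse scale (double_fwd_bwd r) (double_bwd_fwd s)"
    if s: "is_quasiinverse scale r s" for s
  proof -
    \<comment> \<open>An arbitrary quasiinverse \<open>s\<close> agrees with \<open>t\<close> only
      modulo relations, so the exact identities for \<open>t\<close> are carried over to
      \<open>s\<close> by well-definedness.\<close>
    have "TT_equiv scale (double_bwd_fwd s) (double_bwd_fwd t)"
      by (rule double_well_defined(2)[OF is_quasiinverse_unique[OF t(2) s]])
    then have "TT_equiv scale (TT_times (double_fwd_bwd r) (double_bwd_fwd s))
          (TT_times (double_fwd_bwd r) (double_bwd_fwd t))"
      and "TT_equiv scale (TT_times (double_bwd_fwd s) (double_fwd_bwd r))
          (TT_times (double_bwd_fwd t) (double_fwd_bwd r))"
      by (intro TT_times_well_defined fps_equiv_refl subspace_rels; assumption?)+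
    then show ?thesis
      by (simp add: is_TT_inverse_def double_inverse[OF assms(2) t])
  qed
  ultimately show ?thesis using is_quasiinverse_unique[OF t(2)] by blast
qed

end
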